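(* Suppose $\mu$ is a singular cardinal and $\sigma,\theta$ are cardinals with $\sigma$ regular and $\aleph_0\leq\sigma\leq\mathrm{cf}(\mu)<\mathrm{cf}(\theta)\leq\theta<\mu$. Then there is an $\eta<\mu$ such that $$\sup\mathrm{pcf}_{\Gamma(\theta,\sigma)}(A)\leq\mathrm{pp}_{\Gamma(\theta,\sigma)}(\mu)$$ whenever $A$ is a progressive subset of $[\eta,\mu)\cap\mathrm{Reg}$.
   Context: $\mathrm{Reg}$ denotes the class of regular cardinals. A set $A$ of regular cardinals is progressive if $|A|<\min(A)$. $\prod A$ is the set of functions $f$ on $A$ with $f(a)<a$; $\mathrm{tcf}(\prod A/J)=\lambda$ means there is a sequence of length $\lambda$ in $\prod A$, increasing and cofinal modulo the ideal $J$. An ideal is $\sigma$-complete if closed under unions of fewer than $\sigma$ sets. $\mathrm{pcf}_{\Gamma(\theta,\sigma)}(A)$ is the set of cardinals $\lambda$ such that $\lambda=\mathrm{tcf}(\prod A/J)$ for some $\sigma$-complete ideal $J$ on $A$ whose dual filter contains a set of cardinality $<\theta$. For $\mu$ singular and $\sigma=\mathrm{cf}(\sigma)\leq\mathrm{cf}(\mu)<\theta\leq\mu$, $\mathrm{PP}_{\Gamma(\theta,\sigma)}(\mu)$ is the set of cardinals $\lambda$ such that there are a cofinal $A\subseteq\mu\cap\mathrm{Reg}$ with $|A|<\theta$ and a $\sigma$-complete ideal $J$ on $A$ containing all bounded subsets of $A$ with $\lambda=\mathrm{tcf}(\prod A/J)$; $\mathrm{pp}_{\Gamma(\theta,\sigma)}(\mu)=\sup\mathrm{PP}_{\Gamma(\theta,\sigma)}(\mu)$.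 *)

theory Defs
  imports Main "HOL-Library.FuncSet"
begin

unbundle cardinal_syntax

text \<open>
  Cardinals are well-orders satisfying \<^const>\<open>Card_order\<close>, compared by \<open>\<le>o\<close> and \<open><o\<close>.
  For a cardinal \<open>\<mu>\<close>, an element \<open>x\<close> of \<open>Field \<mu>\<close> stands for the ordinal below \<open>\<mu>\<close> that is the
  order type of its strict initial segment \<open>underS \<mu> x\<close>; thus \<open>(x, y) \<in> \<mu>\<close> reads \<open>x \<le> y\<close>.
\<close>

definition ord_of :: "'a rel \<Rightarrow> 'a \<Rightarrow> 'a rel" where
  "ord_of \<mu> x = Restr \<mu> (underS \<mu> x)"

definition regular_cardinal :: "'a rel \<Rightarrow> bool" where
  "regular_cardinal \<kappa> \<longleftrightarrow> Card_order \<kappa> \<and> infinite (Field \<kappa>) \<and> regularCard \<kappa>"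

definition singular_cardinal :: "'a rel \<Rightarrow> bool" where
  "singular_cardinal \<kappa> \<longleftrightarrow> Card_order \<kappa> \<and> infinite (Field \<kappa>) \<and> \<not> regularCard \<kappa>"

definition Reg_below :: "'a rel \<Rightarrow> 'a set" where
  "Reg_below \<mu> = {a \<in> Field \<mu>. regular_cardinal (ord_of \<mu> a)}"

text \<open>
  Since \<^const>\<open>cofinal\<close> is the strict notion, the next definition is meaningful for
  orders without a last element, in particular for infinite cardinals.
\<close>

definition cf :: "'a rel \<Rightarrow> 'a rel" where
  "cf \<kappa> = |SOME K. K \<subseteq> Field \<kappa> \<and> cofinal K \<kappa> \<and>
                 (\<forall>L. L \<subseteq> Field \<kappa> \<and> cofinal L \<kappa> \<longrightarrow> |K| \<le>o |L| )|"

lemma cf_attained: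
  assumes "Card_order \<kappa>" and "infinite (Field \<kappa>)"
  obtains K where "K \<subseteq> Field \<kappa>" "cofinal K \<kappa>" "cf \<kappa> = |K|"
    "\<And>L. L \<subseteq> Field \<kappa> \<Longrightarrow> cofinal L \<kappa> \<Longrightarrow> |K| \<le>o |L|"
proof -
  let ?P = "\<lambda>K. K \<subseteq> Field \<kappa> \<and> cofinal K \<kappa>"
  have "?P (Field \<kappa>)"
    using infinite_Card_order_limit[OF assms] by (auto simp: cofinal_def)
  then have "\<exists>r\<in>card_of ` Collect ?P. \<forall>s\<in>card_of ` Collect ?P. r \<le>o s"
    by (intro exists_minim_Card_order) (auto simp: card_of_Card_order)
  then have "\<exists>K. K \<subseteq> Field \<kappa> \<and> cofinal K \<kappa> \<and> (\<forall>L. ?P L \<longrightarrow> |K| \<le>o |L| )"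
    by auto
  from someI_ex[OF this] show ?thesis
    by (intro that[of "SOME K. K \<subseteq> Field \<kappa> \<and> cofinal K \<kappa> \<and> (\<forall>L. ?P L \<longrightarrow> |K| \<le>o |L| )"])
      (auto simp: cf_def)
qed

definition progressive :: "'a rel \<Rightarrow> 'a set \<Rightarrow> bool" where
  "progressive \<mu> A \<longleftrightarrow>
     A \<subseteq> Reg_below \<mu> \<and> (A \<noteq> {} \<longrightarrow> |A| <o ord_of \<mu> (wo_rel.minim \<mu> A))"

definition Prod :: "'a rel \<Rightarrow> 'a set \<Rightarrow> ('a \<Rightarrow> 'a) set" where
  "Prod \<mu> A = (\<Pi>\<^sub>E a\<in>A. underS \<mu> a)"

definition proper_ideal_on :: "'a set \<Rightarrow> 'a set set \<Rightarrow> bool" where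
  "proper_ideal_on A J \<longleftrightarrow> J \<subseteq> Pow A \<and> {} \<in> J \<and> A \<notin> J \<and>
     (\<forall>X\<in>J. \<forall>Y. Y \<subseteq> X \<longrightarrow> Y \<in> J) \<and> (\<forall>X\<in>J. \<forall>Y\<in>J. X \<union> Y \<in> J)"

definition complete_ideal_on :: "'s rel \<Rightarrow> 'a set \<Rightarrow> 'a set set \<Rightarrow> bool" where
  "complete_ideal_on \<sigma> A J \<longleftrightarrow>
     proper_ideal_on A J \<and> (\<forall>S. S \<subseteq> J \<and> |S| <o \<sigma> \<longrightarrow> \<Union>S \<in> J)"

definition dual_filter :: "'a set \<Rightarrow> 'a set set \<Rightarrow> 'a set set" where
  "dual_filter A J = (\<lambda>X. A - X) ` J"

definition less_mod :: "'a rel \<Rightarrow> 'a set \<Rightarrow> 'a set set \<Rightarrow> ('a \<Rightarrow> 'a) \<Rightarrow> ('a \<Rightarrow> 'a) \<Rightarrow> bool" where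
  "less_mod \<mu> A J f g \<longleftrightarrow> {a\<in>A. \<not> (f a \<noteq> g a \<and> (f a, g a) \<in> \<mu>)} \<in> J"

definition le_mod :: "'a rel \<Rightarrow> 'a set \<Rightarrow> 'a set set \<Rightarrow> ('a \<Rightarrow> 'a) \<Rightarrow> ('a \<Rightarrow> 'a) \<Rightarrow> bool" where
  "le_mod \<mu> A J f g \<longleftrightarrow> {a\<in>A. (f a, g a) \<notin> \<mu>} \<in> J"

text \<open>
  \<open>has_tcf \<mu> A J \<kappa>\<close> is \<open>tcf (\<Prod>A/J) = \<kappa>\<close>. A true cofinality is by convention a regular cardinal;
  this is what makes \<open>\<kappa>\<close> unique.
\<close>

definition has_tcf :: "'a rel \<Rightarrow> 'a set \<Rightarrow> 'a set set \<Rightarrow> 'b rel \<Rightarrow> bool" where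
  "has_tcf \<mu> A J \<kappa> \<longleftrightarrow> regular_cardinal \<kappa> \<and>
     (\<exists>F. (\<forall>\<alpha>\<in>Field \<kappa>. F \<alpha> \<in> Prod \<mu> A) \<and>
          (\<forall>\<alpha> \<beta>. \<alpha> \<noteq> \<beta> \<and> (\<alpha>, \<beta>) \<in> \<kappa> \<longrightarrow> less_mod \<mu> A J (F \<alpha>) (F \<beta>)) \<and>
          (\<forall>g\<in>Prod \<mu> A. \<exists>\<alpha>\<in>Field \<kappa>. le_mod \<mu> A J g (F \<alpha>)))"

text \<open>
  For a proper ideal the witnessing sequence is injective, so every true cofinality of \<open>\<Prod>A/J\<close>
  is represented by a cardinal order on the type of functions \<^typ>\<open>'a \<Rightarrow> 'a\<close>.
\<close>

lemma has_tcf_le_Prod: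
  assumes "has_tcf \<mu> A J \<kappa>" and "proper_ideal_on A J"
  shows "\<kappa> \<le>o |Prod \<mu> A|"
proof -
  obtain F where F: "\<forall>\<alpha>\<in>Field \<kappa>. F \<alpha> \<in> Prod \<mu> A"
    and inc: "\<forall>\<alpha> \<beta>. \<alpha> \<noteq> \<beta> \<and> (\<alpha>, \<beta>) \<in> \<kappa> \<longrightarrow> less_mod \<mu> A J (F \<alpha>) (F \<beta>)"
    and co: "Card_order \<kappa>"
    using assms(1) unfolding has_tcf_def regular_cardinal_def by blast
  have irr: "\<not> less_mod \<mu> A J f f" for f
    using assms(2) by (simp add: less_mod_def proper_ideal_on_def)
  have tot: "(\<alpha>, \<beta>) \<in> \<kappa> \<or> (\<beta>, \<alpha>) \<in> \<kappa>" if "\<alpha> \<in> Field \<kappa>" "\<beta> \<in> Field \<kappa>" "\<alpha> \<noteq> \<beta>" for \<alpha> \<beta>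
    using co that unfolding card_order_on_def well_order_on_def linear_order_on_def total_on_def
    by blast
  have "inj_on F (Field \<kappa>)"
  proof (rule inj_onI, rule ccontr)
    fix \<alpha> \<beta> assume h: "\<alpha> \<in> Field \<kappa>" "\<beta> \<in> Field \<kappa>" "F \<alpha> = F \<beta>" "\<alpha> \<noteq> \<beta>"
    then have "less_mod \<mu> A J (F \<alpha>) (F \<beta>) \<or> less_mod \<mu> A J (F \<beta>) (F \<alpha>)"
      using tot[OF h(1,2,4)] inc by metis
    then show False
      using h(3) irr by simp
  qed
  then have "|Field \<kappa>| \<le>o |Prod \<mu> A|"
    by (rule card_of_ordLeqI) (use F in blast)
  then show ?thesis
    by (rule ordIso_ordLeq_trans[OF ordIso_symmetric[OF card_of_Field_ordIso[OF co]]])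
qed

definition is_card_sup :: "'b rel set \<Rightarrow> 'b rel \<Rightarrow> bool" where
  "is_card_sup X s \<longleftrightarrow> Card_order s \<and> (\<forall>\<kappa>\<in>X. \<kappa> \<le>o s) \<and>
     (\<forall>t::'b rel. Card_order t \<and> (\<forall>\<kappa>\<in>X. \<kappa> \<le>o t) \<longrightarrow> s \<le>o t)"

definition card_sup :: "'b rel set \<Rightarrow> 'b rel" where
  "card_sup X = (SOME s. is_card_sup X s)"

lemma is_card_sup_card_sup:
  fixes X :: "'b rel set"
  assumes "\<And>\<kappa>. \<kappa> \<in> X \<Longrightarrow> Card_order \<kappa>"
  shows "is_card_sup X (card_sup X)"
proof -
  let ?U = "{t :: 'b rel. Card_order t \<and> (\<forall>\<kappa>\<in>X. \<kappa> \<le>o t)}"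
  have "\<kappa> \<le>o |UNIV :: 'b set|" if "\<kappa> \<in> X" for \<kappa>
    by (rule ordIso_ordLeq_trans[OF ordIso_symmetric[OF card_of_Field_ordIso[OF assms[OF that]]]
          card_of_mono1[OF subset_UNIV]])
  then have "|UNIV :: 'b set| \<in> ?U"
    by (simp add: card_of_Card_order)
  then have "\<exists>s\<in>?U. \<forall>t\<in>?U. s \<le>o t"
    by (intro exists_minim_Card_order) auto
  then have "\<exists>s. is_card_sup X s"
    unfolding is_card_sup_def by blast
  then show ?thesis
    unfolding card_sup_def by (rule someI_ex)
qed

definition pcf_Gamma :: "'t rel \<Rightarrow> 's rel \<Rightarrow> 'a rel \<Rightarrow> 'a set \<Rightarrow> ('a \<Rightarrow> 'a) rel set" where
  "pcf_Gamma \<theta> \<sigma> \<mu> A = {\<kappa>. \<exists>J. complete_ideal_on \<sigma> A J \<and>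
     (\<exists>B\<in>dual_filter A J. |B| <o \<theta>) \<and> has_tcf \<mu> A J \<kappa>}"

definition PP_Gamma :: "'t rel \<Rightarrow> 's rel \<Rightarrow> 'a rel \<Rightarrow> ('a \<Rightarrow> 'a) rel set" where
  "PP_Gamma \<theta> \<sigma> \<mu> = {\<kappa>. \<exists>A J. A \<subseteq> Reg_below \<mu> \<and> cofinal A \<mu> \<and> |A| <o \<theta> \<and>
     complete_ideal_on \<sigma> A J \<and>
     (\<forall>B. B \<subseteq> A \<and> (\<exists>x\<in>Field \<mu>. \<forall>b\<in>B. (b, x) \<in> \<mu>) \<longrightarrow> B \<in> J) \<and>
     has_tcf \<mu> A J \<kappa>}"

definition pp_Gamma :: "'t rel \<Rightarrow> 's rel \<Rightarrow> 'a rel \<Rightarrow> ('a \<Rightarrow> 'a) rel" where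
  "pp_Gamma \<theta> \<sigma> \<mu> = card_sup (PP_Gamma \<theta> \<sigma> \<mu>)"

end

theory Submission
  imports Defs
begin

text \<open>
  Suppose the conclusion fails. Along a cofinal \<open>K \<subseteq> \<mu>\<close> of size \<open>cf \<mu>\<close> there are then sets
  \<open>A\<^sub>\<eta>\<close> of regular cardinals in \<open>[\<eta>, \<mu>)\<close> and \<open>\<sigma>\<close>-complete ideals \<open>J\<^sub>\<eta>\<close>, concentrating on sets \<open>B\<^sub>\<eta>\<close>
  of size \<open>< \<theta>\<close>, with \<open>tcf (\<Prod>A\<^sub>\<eta>/J\<^sub>\<eta>) > pp \<mu>\<close>. Let \<open>U\<close> be the union of the \<open>B\<^sub>\<eta>\<close> and let \<open>I\<close> consist of
  the \<open>X \<subseteq> U\<close> with \<open>X \<inter> B\<^sub>\<eta> \<in> J\<^sub>\<eta>\<close> for all large \<open>\<eta>\<close>. Some \<open>C \<notin> I\<close> is such that \<open>\<Prod>U\<close> has a true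
  cofinality \<open>\<tau>\<close> modulo \<open>I\<close> concentrated on \<open>C\<close>; then \<open>\<tau> \<in> PP \<mu>\<close>, so \<open>\<tau>\<close> is smaller than each
  \<open>tcf (\<Prod>A\<^sub>\<eta>/J\<^sub>\<eta>)\<close>. Hence a sequence of length \<open>\<tau>\<close> is bounded on every \<open>A\<^sub>\<eta>\<close> modulo \<open>J\<^sub>\<eta>\<close>, and the
  pointwise supremum of these bounds bounds it modulo \<open>I\<close>, a contradiction.

  The existence of \<open>C\<close> holds for every proper ideal and needs neither generators nor exact upper
  bounds: choose \<open>C\<close> positive with the least \<open>\<tau>\<close> such that modulo every proper ideal extending
  \<open>I\<close> concentrated on \<open>C\<close> some family of size \<open>\<le> \<tau>\<close> is unbounded. Minimality makes the product
  \<open>< \<tau>\<close>-directed, and a universal sequence of length \<open>\<tau>\<close> is then cofinal.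
\<close>

section \<open>Well-orders and cardinals\<close>

lemma Well_order_trans:
  assumes "Well_order r" "(x, y) \<in> r" "(y, z) \<in> r"
  shows "(x, z) \<in> r"
  using assms unfolding order_on_defs trans_def by blast

lemma Well_order_total:
  assumes "Well_order r" "x \<in> Field r" "y \<in> Field r"
  shows "(x, y) \<in> r \<or> (y, x) \<in> r"
  using assms unfolding order_on_defs total_on_def refl_on_def by metis

lemma Well_order_antisym:
  assumes "Well_order r" "(x, y) \<in> r" "(y, x) \<in> r"
  shows "x = y"
  using assms unfolding order_on_defs antisym_def by blast

lemma Card_order_Well_order: "Card_order r \<Longrightarrow> Well_order r"
  unfolding card_order_on_def by blast

lemma not_cofinal_bounded:
  assumes "Well_order r" "S \<subseteq> Field r" "\<not> cofinal S r"
  shows "\<exists>y\<in>Field r. \<forall>s\<in>S. (s, y) \<in> r"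
proof -
  obtain y where y: "y \<in> Field r" "\<forall>s\<in>S. \<not> (y \<noteq> s \<and> (y, s) \<in> r)"
    using assms(3) unfolding cofinal_def by blast
  have "(s, y) \<in> r" if "s \<in> S" for s
    using Well_order_total[OF assms(1) subsetD[OF assms(2) that] y(1)] y(2) that by metis
  with y(1) show ?thesis by blast
qed

lemma regular_cardinal_bounded:
  assumes "regular_cardinal r" "S \<subseteq> Field r" "|S| <o r"
  shows "\<exists>y\<in>Field r. \<forall>s\<in>S. (s, y) \<in> r"
proof (rule not_cofinal_bounded)
  show "Well_order r" "S \<subseteq> Field r"
    using assms by (auto simp: regular_cardinal_def Card_order_Well_order)
  show "\<not> cofinal S r"
    using assms not_ordLess_ordIso unfolding regular_cardinal_def regularCard_def by blast
qed

lemma less_cf_bounded: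
  assumes "Card_order r" "infinite (Field r)" "S \<subseteq> Field r" "|S| <o cf r"
  shows "\<exists>y\<in>Field r. \<forall>s\<in>S. (s, y) \<in> r"
proof (rule not_cofinal_bounded)
  show "Well_order r" "S \<subseteq> Field r"
    using assms by (auto simp: Card_order_Well_order)
  obtain K where K: "cf r = |K|" "\<And>L. L \<subseteq> Field r \<Longrightarrow> cofinal L r \<Longrightarrow> |K| \<le>o |L|"
    by (rule cf_attained[OF assms(1,2)]) blast
  show "\<not> cofinal S r"
  proof
    assume "cofinal S r"
    from K(2)[OF assms(3) this] show False
      using assms(4) K(1) not_ordLess_ordLeq by metis
  qed
qed

section \<open>Initial segments, enumerations and recursion along a cardinal\<close>

lemma Field_ord_of:
  assumes "Well_order \<mu>"
  shows "Field (ord_of \<mu> a) = underS \<mu> a"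
  unfolding ord_of_def
  using assms wo_rel.underS_ofilter[of \<mu> a] Field_Restr_ofilter[of \<mu>]
  by (auto simp: wo_rel_def)

lemma ordLeq_enumeration:
  assumes "Card_order r" "F \<noteq> {}" "|F| \<le>o r"
  obtains e where "e ` Field r = F"
proof -
  have "|F| \<le>o |Field r|"
    by (rule ordLeq_ordIso_trans[OF assms(3) ordIso_symmetric[OF card_of_Field_ordIso[OF assms(1)]]])
  then have "\<exists>e. e ` Field r = F" by (rule iffD2[OF card_of_ordLeq2[OF assms(2)]])
  then show ?thesis using that by (elim exE)
qed

lemma card_of_image_Field_ordLeq:
  assumes "Card_order r"
  shows "|f ` Field r| \<le>o r"
  by (rule ordLeq_ordIso_trans[OF card_of_image card_of_Field_ordIso[OF assms]])

lemma card_of_image_underS_ordLess: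
  assumes "Card_order r" "x \<in> Field r"
  shows "|f ` underS r x| <o r"
  by (rule ordLeq_ordLess_trans[OF card_of_image card_of_underS[OF assms]])

text \<open>Choosing a point of \<open>E (s \<xi>) - E \<xi>\<close> at each successor step injects
  \<open>Field \<rho>\<close> into \<open>A\<close>. This contradiction ends both iterations of
  length \<open>\<rho>\<close> below.\<close>

lemma no_strict_chain_of_subsets:
  assumes \<rho>: "Card_order \<rho>" "infinite (Field \<rho>)" "|A| <o \<rho>"
    and E: "\<And>\<xi>. \<xi> \<in> Field \<rho> \<Longrightarrow> E \<xi> \<subseteq> A"
    and strict: "\<And>\<xi> \<xi>'. (\<xi>, \<xi>') \<in> \<rho> \<Longrightarrow> \<xi> \<noteq> \<xi>' \<Longrightarrow> E \<xi> \<subset> E \<xi>'"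
  shows False
proof -
  have wo: "wo_rel \<rho>" using \<rho>(1) Card_order_Well_order by (auto simp: wo_rel_def)
  define s where "s \<xi> = wo_rel.suc \<rho> {\<xi>}" for \<xi>
  have ex: "AboveS \<rho> {\<xi>} \<noteq> {}" if "\<xi> \<in> Field \<rho>" for \<xi>
    using infinite_Card_order_limit[OF \<rho>(1,2) that] by (auto simp: AboveS_def)
  have s1: "(\<xi>, s \<xi>) \<in> \<rho> \<and> \<xi> \<noteq> s \<xi>" if "\<xi> \<in> Field \<rho>" for \<xi>
    using wo_rel.suc_greater[OF wo, of "{\<xi>}" \<xi>] ex[OF that] that
    by (auto simp: s_def)
  have s2: "(s \<xi>, \<xi>') \<in> \<rho>" if "(\<xi>, \<xi>') \<in> \<rho>" "\<xi> \<noteq> \<xi>'" for \<xi> \<xi>'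
    using wo_rel.suc_least_AboveS[OF wo, of \<xi>' "{\<xi>}"] that
    by (auto simp: s_def AboveS_def Field_def)
  have "\<forall>\<xi>\<in>Field \<rho>. \<exists>a. a \<in> E (s \<xi>) - E \<xi>"
  proof
    fix \<xi> assume "\<xi> \<in> Field \<rho>"
    then have "E \<xi> \<subset> E (s \<xi>)" using s1 by (intro strict) auto
    then show "\<exists>a. a \<in> E (s \<xi>) - E \<xi>" by blast
  qed
  then obtain c where c: "\<And>\<xi>. \<xi> \<in> Field \<rho> \<Longrightarrow> c \<xi> \<in> E (s \<xi>) - E \<xi>"
    unfolding bchoice_iff by blast
  have ne: "c \<xi> \<noteq> c \<xi>'" if "(\<xi>, \<xi>') \<in> \<rho>" "\<xi> \<noteq> \<xi>'" for \<xi> \<xi>'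
  proof -
    have "E (s \<xi>) \<subseteq> E \<xi>'"
      using strict[OF s2[OF that]] by (cases "s \<xi> = \<xi>'") auto
    then show ?thesis
      using c[OF FieldI1[OF that(1)]] c[OF FieldI2[OF that(1)]] by auto
  qed
  have "inj_on c (Field \<rho>)"
  proof (rule inj_onI, rule ccontr)
    fix \<xi> \<xi>' assume "\<xi> \<in> Field \<rho>" "\<xi>' \<in> Field \<rho>" "c \<xi> = c \<xi>'" "\<xi> \<noteq> \<xi>'"
    then show False
      using Well_order_total[OF Card_order_Well_order[OF \<rho>(1)], of \<xi> \<xi>'] ne[of \<xi> \<xi>'] ne[of \<xi>' \<xi>]
      by auto
  qed
  moreover have "c \<xi> \<in> A" if "\<xi> \<in> Field \<rho>" for \<xi>
    using c[OF that] E[of "s \<xi>"] s1[OF that] by (auto simp: Field_def)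
  ultimately have "|Field \<rho>| \<le>o |A|" by (rule card_of_ordLeqI)
  from ordIso_ordLeq_trans[OF ordIso_symmetric[OF card_of_Field_ordIso[OF \<rho>(1)]] this]
  show False using not_ordLess_ordLeq[OF \<rho>(3)] by contradiction
qed

text \<open>Recursion along \<open>\<rho>\<close>: each stage bounds the fewer than
  \<open>\<rho>\<close> values of \<open>u\<close> at the earlier stages. In the applications
  \<open>u\<close> is a one-step improvement that forces a subset of the index set to grow.\<close>

lemma transfinite_iteration:
  assumes \<rho>: "Card_order \<rho>"
    and u: "\<And>s. s \<in> S \<Longrightarrow> u s \<in> S"
    and ub: "\<And>T. T \<subseteq> S \<Longrightarrow> |T| <o \<rho> \<Longrightarrow> \<exists>s\<in>S. \<forall>t\<in>T. R t s"
  obtains h where "\<And>\<xi>. \<xi> \<in> Field \<rho> \<Longrightarrow> h \<xi> \<in> S"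
    "\<And>\<xi> \<xi>'. (\<xi>, \<xi>') \<in> \<rho> \<Longrightarrow> \<xi> \<noteq> \<xi>' \<Longrightarrow> R (u (h \<xi>)) (h \<xi>')"
proof -
  let ?P = "\<lambda>f x r. x \<in> Field \<rho> \<longrightarrow> r \<in> S \<and> (\<forall>z. (z, x) \<in> \<rho> - Id \<longrightarrow> R (u (f z)) r)"
  have "\<exists>h. \<forall>x. ?P h x (h x)"
  proof (rule dependent_wf_choice)
    show "wf (\<rho> - Id)"
      using Card_order_Well_order[OF \<rho>] by (simp add: well_order_on_def)
    show "?P f x r = ?P g x r" if "\<And>z. (z, x) \<in> \<rho> - Id \<Longrightarrow> f z = g z" for f g x r
      using that by auto
    fix x f assume IH: "\<And>y. (y, x) \<in> \<rho> - Id \<Longrightarrow> ?P f y (f y)"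
    show "\<exists>r. ?P f x r"
    proof (cases "x \<in> Field \<rho>")
      case True
      have "(\<lambda>z. u (f z)) ` underS \<rho> x \<subseteq> S"
        using IH u by (auto simp: underS_def Field_def)
      from ub[OF this card_of_image_underS_ordLess[OF \<rho> True]] obtain s
        where s: "s \<in> S" "\<forall>z\<in>underS \<rho> x. R (u (f z)) s" by auto
      have "?P f x s" using s by (auto simp: underS_def)
      then show ?thesis by blast
    qed simp
  qed
  then obtain h where h: "\<forall>x. ?P h x (h x)" ..
  show ?thesis
  proof (rule that[of h])
    show "h \<xi> \<in> S" if "\<xi> \<in> Field \<rho>" for \<xi> using h that by blast
    show "R (u (h \<xi>)) (h \<xi>')" if "(\<xi>, \<xi>') \<in> \<rho>" "\<xi> \<noteq> \<xi>'" for \<xi> \<xi>'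
      using h[rule_format, of \<xi>'] FieldI2[OF that(1)] that by blast
  qed
qed

section \<open>Products of regular cardinals modulo an ideal\<close>

lemma proper_idealD:
  assumes "proper_ideal_on A I"
  shows "X \<in> I \<Longrightarrow> X \<subseteq> A" "{} \<in> I" "A \<notin> I" "X \<in> I \<Longrightarrow> Y \<subseteq> X \<Longrightarrow> Y \<in> I"
    "X \<in> I \<Longrightarrow> Y \<in> I \<Longrightarrow> X \<union> Y \<in> I"
  using assms unfolding proper_ideal_on_def by blast+

lemma le_mod_transitive:
  assumes "Well_order \<mu>" "proper_ideal_on A I" "le_mod \<mu> A I f g" "le_mod \<mu> A I g h"
  shows "le_mod \<mu> A I f h"
proof -
  have "{a \<in> A. (f a, h a) \<notin> \<mu>} \<subseteq> {a \<in> A. (f a, g a) \<notin> \<mu>} \<union> {a \<in> A. (g a, h a) \<notin> \<mu>}"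
    using Well_order_trans[OF assms(1)] by blast
  then show ?thesis
    using proper_idealD(4,5)[OF assms(2)] assms(3,4) unfolding le_mod_def by blast
qed

lemma less_mod_le_mod:
  assumes "proper_ideal_on A I" "less_mod \<mu> A I f g"
  shows "le_mod \<mu> A I f g"
  using assms(2) unfolding le_mod_def less_mod_def
  by (rule proper_idealD(4)[OF assms(1)]) blast

text \<open>For an ideal \<open>J\<close> on \<open>A\<close> and \<open>B \<subseteq> A\<close>
  this is the ideal generated by \<open>J\<close> and \<open>A - B\<close>. Changing the ideal
  rather than its domain keeps the product over \<open>A\<close> fixed.\<close>

definition concentrate :: "'a set \<Rightarrow> 'a set set \<Rightarrow> 'a set \<Rightarrow> 'a set set" where
  "concentrate A J B = {X. X \<subseteq> A \<and> X \<inter> B \<in> J}"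

lemma proper_ideal_concentrate:
  assumes "proper_ideal_on A J" "B \<subseteq> A" "B \<notin> J"
  shows "proper_ideal_on A (concentrate A J B)"
proof -
  have "A \<inter> B = B" using assms by blast
  moreover have "(X \<union> Y) \<inter> B = (X \<inter> B) \<union> (Y \<inter> B)" for X Y by blast
  moreover have "Y \<inter> B \<in> J" if "X \<inter> B \<in> J" "Y \<subseteq> X" for X Y
    using proper_idealD(4)[OF assms(1) that(1)] that(2) by blast
  ultimately show ?thesis
    using assms(3) proper_idealD(2,5)[OF assms(1)] unfolding proper_ideal_on_def concentrate_def
    by (simp add: subset_iff) blast
qed

lemma complete_ideal_concentrate:
  assumes "complete_ideal_on \<sigma> A J" "B \<subseteq> A" "B \<notin> J"
  shows "complete_ideal_on \<sigma> A (concentrate A J B)"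
  unfolding complete_ideal_on_def
proof (intro conjI allI impI)
  show "proper_ideal_on A (concentrate A J B)"
    using assms proper_ideal_concentrate by (auto simp: complete_ideal_on_def)
  fix S assume S: "S \<subseteq> concentrate A J B \<and> |S| <o \<sigma>"
  have "(\<lambda>X. X \<inter> B) ` S \<subseteq> J" using S by (auto simp: concentrate_def)
  moreover have "|(\<lambda>X. X \<inter> B) ` S| <o \<sigma>" using S ordLeq_ordLess_trans[OF card_of_image] by blast
  ultimately have "\<Union>((\<lambda>X. X \<inter> B) ` S) \<in> J"
    using assms(1) unfolding complete_ideal_on_def by blast
  moreover have "\<Union>((\<lambda>X. X \<inter> B) ` S) = \<Union>S \<inter> B" by blast
  ultimately show "\<Union>S \<in> concentrate A J B"
    using S by (auto simp: concentrate_def)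
qed

text \<open>The cardinal \<open>\<rho>\<close> is the length of the iterations: too long for a
  strict chain of subsets of \<open>A\<close>, yet short enough that \<open>\<rho>\<close> functions
  have a pointwise bound. The final theorem takes \<open>\<theta>\<close> for
  \<open>\<rho>\<close>.\<close>

locale regular_product =
  fixes \<mu> :: "'a rel" and A :: "'a set" and \<rho> :: "'r rel"
  assumes wo: "Well_order \<mu>" and A: "A \<subseteq> Reg_below \<mu>"
    and \<rho>: "Card_order \<rho>" "infinite (Field \<rho>)"
    and A_\<rho>: "|A| <o \<rho>" and \<rho>_less: "\<And>a. a \<in> A \<Longrightarrow> \<rho> <o ord_of \<mu> a"
begin

abbreviation "P \<equiv> Prod \<mu> A"

abbreviation pw_le :: "('a \<Rightarrow> 'a) \<Rightarrow> ('a \<Rightarrow> 'a) \<Rightarrow> bool" where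
  "pw_le f g \<equiv> \<forall>a\<in>A. (f a, g a) \<in> \<mu>"

definition bdd :: "'a set set \<Rightarrow> ('a \<Rightarrow> 'a) set \<Rightarrow> bool" where
  "bdd I F \<longleftrightarrow> (\<exists>g\<in>P. \<forall>f\<in>F. le_mod \<mu> A I f g)"

section \<open>Pointwise bounds in the product\<close>

lemma P_underS: "f \<in> P \<Longrightarrow> a \<in> A \<Longrightarrow> f a \<in> underS \<mu> a"
  by (auto simp: Prod_def)

lemma P_Field: "f \<in> P \<Longrightarrow> a \<in> A \<Longrightarrow> f a \<in> Field \<mu>"
  by (drule P_underS) (auto simp: underS_def Field_def)

lemma P_choice:
  assumes "\<And>a. a \<in> A \<Longrightarrow> \<exists>y\<in>underS \<mu> a. Q a y"
  shows "\<exists>g\<in>P. \<forall>a\<in>A. Q a (g a)"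
proof -
  from bchoice[of A "\<lambda>a y. y \<in> underS \<mu> a \<and> Q a y"] assms
  obtain g where "\<forall>a\<in>A. g a \<in> underS \<mu> a \<and> Q a (g a)" by blast
  then show ?thesis
    by (intro bexI[of _ "restrict g A"]) (auto simp: Prod_def)
qed

lemma pw_trans: "pw_le f g \<Longrightarrow> pw_le g h \<Longrightarrow> pw_le f h"
  using Well_order_trans[OF wo] by blast

text \<open>At each \<open>a\<close> there are at most \<open>\<rho>\<close> values, too few to be
  unbounded in the regular cardinal \<open>a\<close>.\<close>

lemma pw_bound:
  assumes "T \<subseteq> P" "|T| \<le>o \<rho>"
  shows "\<exists>g\<in>P. \<forall>f\<in>T. pw_le f g"
proof -
  have "\<exists>g\<in>P. \<forall>a\<in>A. \<forall>f\<in>T. (f a, g a) \<in> \<mu>"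
  proof (rule P_choice)
    fix a assume a: "a \<in> A"
    have "regular_cardinal (ord_of \<mu> a)"
      using a A by (auto simp: Reg_below_def)
    moreover have "(\<lambda>f. f a) ` T \<subseteq> Field (ord_of \<mu> a)"
      using assms(1) P_underS a by (auto simp: Field_ord_of[OF wo])
    moreover have "|(\<lambda>f. f a) ` T| <o ord_of \<mu> a"
      by (rule ordLeq_ordLess_trans[OF ordLeq_transitive[OF card_of_image assms(2)] \<rho>_less[OF a]])
    ultimately have "\<exists>y\<in>Field (ord_of \<mu> a). \<forall>s\<in>(\<lambda>f. f a) ` T. (s, y) \<in> ord_of \<mu> a"
      by (rule regular_cardinal_bounded)
    then show "\<exists>y\<in>underS \<mu> a. \<forall>f\<in>T. (f a, y) \<in> \<mu>"
      by (auto simp: Field_ord_of[OF wo]) (auto simp: ord_of_def)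
  qed
  then show ?thesis by blast
qed

lemma pw_max:
  assumes "f \<in> P" "g \<in> P"
  obtains h where "h \<in> P" "pw_le f h" "pw_le g h"
proof -
  have "|{f, g}| \<le>o \<rho>"
    using \<rho> Card_order_Well_order card_of_Well_order
    by (intro ordLess_imp_ordLeq finite_ordLess_infinite) (auto simp: Field_card_of)
  with pw_bound[of "{f, g}"] assms that show ?thesis by auto
qed

lemma pw_succ:
  assumes "f \<in> P"
  obtains g where "g \<in> P" "\<And>a. a \<in> A \<Longrightarrow> (f a, g a) \<in> \<mu>" "\<And>a. a \<in> A \<Longrightarrow> f a \<noteq> g a"
proof -
  have "\<exists>g\<in>P. \<forall>a\<in>A. f a \<noteq> g a \<and> (f a, g a) \<in> \<mu>"
  proof (rule P_choice)
    fix a assume a: "a \<in> A"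
    have "Card_order (ord_of \<mu> a)" "infinite (Field (ord_of \<mu> a))"
      using a A by (auto simp: Reg_below_def regular_cardinal_def)
    from infinite_Card_order_limit[OF this, of "f a"] P_underS[OF assms a]
    show "\<exists>y\<in>underS \<mu> a. f a \<noteq> y \<and> (f a, y) \<in> \<mu>"
      by (auto simp: Field_ord_of[OF wo]) (auto simp: ord_of_def)
  qed
  then show ?thesis using that by blast
qed

lemma le_mod_pw:
  assumes "proper_ideal_on A I" "pw_le f g"
  shows "le_mod \<mu> A I f g"
proof -
  have "{a \<in> A. (f a, g a) \<notin> \<mu>} = {}" using assms(2) by blast
  then show ?thesis unfolding le_mod_def using proper_idealD(2)[OF assms(1)] by (rule ssubst)
qed

lemma le_mod_mono: "le_mod \<mu> A I f g \<Longrightarrow> I \<subseteq> I' \<Longrightarrow> le_mod \<mu> A I' f g"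
  by (auto simp: le_mod_def)

lemmas le_mod_trans = le_mod_transitive[OF wo]

lemma bddE:
  assumes "bdd I F"
  obtains g where "g \<in> P" "\<And>f. f \<in> F \<Longrightarrow> le_mod \<mu> A I f g"
  using assms unfolding bdd_def by blast

lemma bdd_small:
  assumes "proper_ideal_on A I" "F \<subseteq> P" "|F| \<le>o \<rho>"
  shows "bdd I F"
  using pw_bound[OF assms(2,3)] le_mod_pw[OF assms(1)] unfolding bdd_def by blast

text \<open>The pointwise successor of a bound exceeds it at every \<open>a\<close>, so the
  exceptional set would be all of \<open>A\<close>.\<close>

lemma not_bdd_P:
  assumes "proper_ideal_on A I"
  shows "\<not> bdd I P"
proof
  assume "bdd I P"
  then obtain g where g: "g \<in> P" "\<And>f. f \<in> P \<Longrightarrow> le_mod \<mu> A I f g" by (rule bddE) blast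
  obtain h where h: "h \<in> P" "\<And>a. a \<in> A \<Longrightarrow> (g a, h a) \<in> \<mu>" "\<And>a. a \<in> A \<Longrightarrow> g a \<noteq> h a"
    using pw_succ[OF g(1)] by blast
  have "{a \<in> A. (h a, g a) \<notin> \<mu>} = A"
    using h Well_order_antisym[OF wo] by blast
  then show False
    using g(2)[OF h(1)] proper_idealD(3)[OF assms] by (simp add: le_mod_def)
qed

section \<open>Sequences increasing modulo an ideal, and bounded families\<close>

definition increasing :: "'l rel \<Rightarrow> 'a set set \<Rightarrow> ('l \<Rightarrow> 'a \<Rightarrow> 'a) \<Rightarrow> bool" where
  "increasing \<kappa> J f \<longleftrightarrow> (\<forall>\<alpha>\<in>Field \<kappa>. f \<alpha> \<in> P) \<and>
     (\<forall>\<alpha> \<beta>. \<alpha> \<noteq> \<beta> \<and> (\<alpha>, \<beta>) \<in> \<kappa> \<longrightarrow> less_mod \<mu> A J (f \<alpha>) (f \<beta>))"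

lemma increasing_in: "increasing \<kappa> J f \<Longrightarrow> \<alpha> \<in> Field \<kappa> \<Longrightarrow> f \<alpha> \<in> P"
  by (simp add: increasing_def)

lemma increasing_le_mod:
  assumes "proper_ideal_on A J" "increasing \<kappa> J f" "(\<alpha>, \<beta>) \<in> \<kappa>"
  shows "le_mod \<mu> A J (f \<alpha>) (f \<beta>)"
proof (cases "\<alpha> = \<beta>")
  case True
  have "f \<beta> \<in> P" using assms by (auto simp: increasing_def Field_def)
  then have "pw_le (f \<beta>) (f \<beta>)"
    using Well_order_total[OF wo] P_Field by blast
  then show ?thesis using le_mod_pw[OF assms(1)] True by blast
next
  case False
  then have "less_mod \<mu> A J (f \<alpha>) (f \<beta>)" using assms(2,3) by (simp add: increasing_def)
  then show ?thesis by (rule less_mod_le_mod[OF assms(1)])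
qed

text \<open>By recursion: directedness bounds the fewer than \<open>\<kappa>\<close> earlier terms,
  the maximum with \<open>p\<close> is taken, and a pointwise successor makes the inequality
  strict.\<close>

lemma increasing_dominating:
  fixes \<kappa> :: "'l rel"
  assumes J: "proper_ideal_on A J" and \<kappa>: "Card_order \<kappa>"
    and dir: "\<And>F. F \<subseteq> P \<Longrightarrow> |F| <o \<kappa> \<Longrightarrow> bdd J F"
    and p: "\<And>\<alpha>. \<alpha> \<in> Field \<kappa> \<Longrightarrow> p \<alpha> \<in> P"
  obtains f where "increasing \<kappa> J f" "\<And>\<alpha>. \<alpha> \<in> Field \<kappa> \<Longrightarrow> pw_le (p \<alpha>) (f \<alpha>)"
proof -
  let ?Q = "\<lambda>f \<alpha> r. \<alpha> \<in> Field \<kappa> \<longrightarrow> r \<in> P \<and> pw_le (p \<alpha>) r \<and>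
              (\<forall>\<beta>. (\<beta>, \<alpha>) \<in> \<kappa> - Id \<longrightarrow> less_mod \<mu> A J (f \<beta>) r)"
  have "\<exists>h. \<forall>x. ?Q h x (h x)"
  proof (rule dependent_wf_choice)
    show "wf (\<kappa> - Id)"
      using Card_order_Well_order[OF \<kappa>] by (simp add: well_order_on_def)
    show "?Q f x r = ?Q g x r" if "\<And>z. (z, x) \<in> \<kappa> - Id \<Longrightarrow> f z = g z" for f g x r
      using that by auto
    fix x f assume IH: "\<And>y. (y, x) \<in> \<kappa> - Id \<Longrightarrow> ?Q f y (f y)"
    show "\<exists>r. ?Q f x r"
    proof (cases "x \<in> Field \<kappa>")
      case True
      have "f ` underS \<kappa> x \<subseteq> P"
        using IH by (auto simp: underS_def Field_def)
      from dir[OF this card_of_image_underS_ordLess[OF \<kappa> True]] obtain g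
        where g: "g \<in> P" "\<And>z. z \<in> underS \<kappa> x \<Longrightarrow> le_mod \<mu> A J (f z) g"
        by (auto elim!: bddE)
      obtain h where h: "h \<in> P" "pw_le g h" "pw_le (p x) h"
        using pw_max[OF g(1) p[OF True]] by blast
      obtain k where k: "k \<in> P" "\<And>a. a \<in> A \<Longrightarrow> (h a, k a) \<in> \<mu>" "\<And>a. a \<in> A \<Longrightarrow> h a \<noteq> k a"
        using pw_succ[OF h(1)] by blast
      have "less_mod \<mu> A J (f z) k" if "(z, x) \<in> \<kappa> - Id" for z
      proof -
        have "{a \<in> A. \<not> (f z a \<noteq> k a \<and> (f z a, k a) \<in> \<mu>)} \<subseteq> {a \<in> A. (f z a, g a) \<notin> \<mu>}"
        proof -
          have "f z a \<noteq> k a \<and> (f z a, k a) \<in> \<mu>" if a: "a \<in> A" "(f z a, g a) \<in> \<mu>" for a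
          proof -
            have fh: "(f z a, h a) \<in> \<mu>" using a h(2) Well_order_trans[OF wo] by blast
            then have "f z a \<noteq> k a"
              using k(2,3)[OF a(1)] Well_order_antisym[OF wo] by metis
            moreover have "(f z a, k a) \<in> \<mu>" using fh a k(2) Well_order_trans[OF wo] by blast
            ultimately show ?thesis ..
          qed
          then show ?thesis by blast
        qed
        moreover have "le_mod \<mu> A J (f z) g" using that by (intro g(2)) (auto simp: underS_def)
        ultimately show ?thesis
          unfolding le_mod_def less_mod_def using proper_idealD(4)[OF J] by blast
      qed
      moreover have "pw_le (p x) k" using h(3) k(2) Well_order_trans[OF wo] by blast
      ultimately show ?thesis using k(1) by blast
    qed simp
  qed
  then obtain h where h: "\<forall>x. ?Q h x (h x)" ..
  show ?thesis
    by (rule that[of h]) (use h in \<open>auto simp: Field_def increasing_def\<close>)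
qed

text \<open>Families of size at most \<open>\<rho>\<close> have pointwise bounds, which leaves a
  non-regular \<open>\<kappa>\<close> above \<open>\<rho>\<close>. A short cofinal set then cuts an
  enumeration of \<open>F\<close> into initial segments of size below \<open>\<kappa>\<close>; each
  is bounded, and so is the small set of their bounds.\<close>

lemma bdd_of_singular:
  assumes J: "proper_ideal_on A J" and \<kappa>: "Card_order \<kappa>"
    and dir: "\<And>F. F \<subseteq> P \<Longrightarrow> |F| <o \<kappa> \<Longrightarrow> bdd J F"
    and nreg: "\<not> (regularCard \<kappa> \<and> \<rho> <o \<kappa>)"
    and F: "F \<subseteq> P" "|F| \<le>o \<kappa>"
  shows "bdd J F"
proof (cases "|F| \<le>o \<rho>")
  case True
  then show ?thesis using bdd_small J F by blast
next
  case False
  then have \<rho>F: "\<rho> <o |F|"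
    using not_ordLeq_iff_ordLess[OF Card_order_Well_order[OF \<rho>(1)] card_of_Well_order] by blast
  have "F \<noteq> {}"
    using False card_of_empty1[of \<rho>] \<rho>(1) by auto
  have "\<rho> <o \<kappa>" by (rule ordLess_ordLeq_trans[OF \<rho>F F(2)])
  with nreg obtain K where K: "K \<subseteq> Field \<kappa>" "cofinal K \<kappa>" "\<not> |K| =o \<kappa>"
    unfolding regularCard_def by blast
  have "|K| \<le>o \<kappa>"
    by (rule ordLeq_ordIso_trans[OF card_of_mono1[OF K(1)] card_of_Field_ordIso[OF \<kappa>]])
  with K(3) have K\<kappa>: "|K| <o \<kappa>" using ordLeq_iff_ordLess_or_ordIso by blast
  obtain e where e: "e ` Field \<kappa> = F" using ordLeq_enumeration[OF \<kappa> \<open>F \<noteq> {}\<close> F(2)] .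
  have "\<exists>g\<in>P. \<forall>\<beta>\<in>underS \<kappa> k. le_mod \<mu> A J (e \<beta>) g" if "k \<in> K" for k
  proof -
    have "e ` underS \<kappa> k \<subseteq> P" using e F(1) by (auto simp: underS_def Field_def)
    moreover have "|e ` underS \<kappa> k| <o \<kappa>"
      using card_of_image_underS_ordLess[OF \<kappa>] K(1) that by blast
    ultimately have "bdd J (e ` underS \<kappa> k)" by (rule dir)
    then show ?thesis by (auto elim!: bddE)
  qed
  then obtain g where g: "\<And>k. k \<in> K \<Longrightarrow> g k \<in> P"
    "\<And>k \<beta>. k \<in> K \<Longrightarrow> \<beta> \<in> underS \<kappa> k \<Longrightarrow> le_mod \<mu> A J (e \<beta>) (g k)"
    using bchoice[of K "\<lambda>k g. g \<in> P \<and> (\<forall>\<beta>\<in>underS \<kappa> k. le_mod \<mu> A J (e \<beta>) g)"] by blast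
  have "bdd J (g ` K)"
    using g(1) ordLeq_ordLess_trans[OF card_of_image K\<kappa>] by (intro dir) blast+
  then obtain h where h: "h \<in> P" "\<And>k. k \<in> K \<Longrightarrow> le_mod \<mu> A J (g k) h" by (auto elim!: bddE)
  have "le_mod \<mu> A J f h" if f: "f \<in> F" for f
  proof -
    obtain \<beta> where \<beta>: "\<beta> \<in> Field \<kappa>" "f = e \<beta>" using e f by blast
    then obtain k where "k \<in> K" "\<beta> \<in> underS \<kappa> k"
      using K(2) by (auto simp: cofinal_def underS_def)
    then show ?thesis using g(2) h(2) le_mod_trans[OF J] \<beta>(2) by blast
  qed
  then show ?thesis using h(1) unfolding bdd_def by blast
qed

text \<open>If \<open>F\<close> were unbounded, passing repeatedly from \<open>h\<close> to a local
  bound \<open>u h\<close>, through \<open>\<rho>\<close> stages, would give a strict chain of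
  subsets of \<open>A\<close>. The hypothesis \<open>loc\<close> provides the ideals, one below each
  positive set, that make local bounds available.\<close>

lemma bdd_of_regular:
  fixes \<kappa> :: "'l rel"
  assumes J: "proper_ideal_on A J" and \<kappa>: "regular_cardinal \<kappa>" "\<rho> <o \<kappa>"
    and dir: "\<And>F. F \<subseteq> P \<Longrightarrow> |F| <o \<kappa> \<Longrightarrow> bdd J F"
    and loc: "\<And>X. X \<subseteq> A \<Longrightarrow> X \<notin> J \<Longrightarrow> \<exists>I. proper_ideal_on A I \<and> J \<subseteq> I \<and> A - X \<in> I \<and>
                (\<forall>F. F \<subseteq> P \<longrightarrow> |F| \<le>o \<kappa> \<longrightarrow> bdd I F)"
    and F: "F \<subseteq> P" "|F| \<le>o \<kappa>"
  shows "bdd J F"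
proof (cases "F = {}")
  case True
  then show ?thesis using bdd_small[OF J] \<rho>(1) Card_order_Well_order[OF \<rho>(1)] card_of_empty1 by auto
next
  case False
  have co: "Card_order \<kappa>" using \<kappa> by (simp add: regular_cardinal_def)
  obtain e where e: "e ` Field \<kappa> = F" using ordLeq_enumeration[OF co False F(2)] .
  \<comment> \<open>It is enough to bound \<open>f\<close>, which dominates the enumeration
    \<open>e\<close> of \<open>F\<close> pointwise.\<close>
  obtain f where f: "increasing \<kappa> J f" "\<And>\<alpha>. \<alpha> \<in> Field \<kappa> \<Longrightarrow> pw_le (e \<alpha>) (f \<alpha>)"
    by (rule increasing_dominating[OF J co dir, of e]) (use e F(1) in blast)+
  show ?thesis
  proof (rule ccontr)
    assume nb: "\<not> bdd J F"
    \<comment> \<open>Since \<open>h\<close> does not bound \<open>F\<close>, some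
      \<open>f \<alpha>\<close> exceeds it on a positive set. Applying \<open>loc\<close> to that
      set gives \<open>I\<close>; \<open>u\<close> bounds all of \<open>f\<close> modulo
      \<open>I\<close> and lies pointwise above \<open>h\<close>.\<close>
    have "\<forall>h\<in>P. \<exists>\<alpha> I u. \<alpha> \<in> Field \<kappa> \<and> proper_ideal_on A I \<and> J \<subseteq> I \<and>
        A - {a \<in> A. (f \<alpha> a, h a) \<notin> \<mu>} \<in> I \<and>
        u \<in> P \<and> pw_le h u \<and> (\<forall>\<beta>\<in>Field \<kappa>. le_mod \<mu> A I (f \<beta>) u)"
    proof
      fix h assume h: "h \<in> P"
      obtain \<alpha> where \<alpha>: "\<alpha> \<in> Field \<kappa>" "\<not> le_mod \<mu> A J (f \<alpha>) h"
        using nb e f(2) h le_mod_pw[OF J] le_mod_trans[OF J] unfolding bdd_def by blast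
      have "{a \<in> A. (f \<alpha> a, h a) \<notin> \<mu>} \<notin> J"
        using \<alpha>(2) by (simp add: le_mod_def)
      from loc[OF _ this] obtain I where I: "proper_ideal_on A I" "J \<subseteq> I"
        "A - {a \<in> A. (f \<alpha> a, h a) \<notin> \<mu>} \<in> I" "\<forall>F. F \<subseteq> P \<longrightarrow> |F| \<le>o \<kappa> \<longrightarrow> bdd I F" by auto
      have "f ` Field \<kappa> \<subseteq> P" using f(1) by (auto simp: increasing_def)
      then have "bdd I (f ` Field \<kappa>)" using I(4) card_of_image_Field_ordLeq[OF co] by blast
      then obtain v where v: "v \<in> P" "\<And>\<beta>. \<beta> \<in> Field \<kappa> \<Longrightarrow> le_mod \<mu> A I (f \<beta>) v" by (auto elim!: bddE)
      obtain u where "u \<in> P" "pw_le h u" "pw_le v u" using pw_max[OF h v(1)] by blast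
      moreover have "le_mod \<mu> A I (f \<beta>) u" if "\<beta> \<in> Field \<kappa>" for \<beta>
        using le_mod_trans[OF I(1) v(2)[OF that] le_mod_pw[OF I(1) \<open>pw_le v u\<close>]] .
      ultimately show "\<exists>\<alpha> I u. \<alpha> \<in> Field \<kappa> \<and> proper_ideal_on A I \<and> J \<subseteq> I \<and>
          A - {a \<in> A. (f \<alpha> a, h a) \<notin> \<mu>} \<in> I \<and>
          u \<in> P \<and> pw_le h u \<and> (\<forall>\<beta>\<in>Field \<kappa>. le_mod \<mu> A I (f \<beta>) u)"
        using \<alpha>(1) I(1,2,3)
        by (intro exI[of _ \<alpha>] exI[of _ I] exI[of _ u] conjI ballI) simp_all
    qed
    then obtain al I u where "\<forall>h\<in>P. al h \<in> Field \<kappa> \<and> proper_ideal_on A (I h) \<and> J \<subseteq> I h \<and>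
        A - {a \<in> A. (f (al h) a, h a) \<notin> \<mu>} \<in> I h \<and>
        u h \<in> P \<and> pw_le h (u h) \<and> (\<forall>\<beta>\<in>Field \<kappa>. le_mod \<mu> A (I h) (f \<beta>) (u h))"
      unfolding bchoice_iff by (elim exE)
    then have *: "\<And>h. h \<in> P \<Longrightarrow> al h \<in> Field \<kappa>" "\<And>h. h \<in> P \<Longrightarrow> proper_ideal_on A (I h)"
      "\<And>h. h \<in> P \<Longrightarrow> J \<subseteq> I h" "\<And>h. h \<in> P \<Longrightarrow> A - {a \<in> A. (f (al h) a, h a) \<notin> \<mu>} \<in> I h"
      "\<And>h. h \<in> P \<Longrightarrow> u h \<in> P" "\<And>h. h \<in> P \<Longrightarrow> pw_le h (u h)"
      "\<And>h \<beta>. h \<in> P \<Longrightarrow> \<beta> \<in> Field \<kappa> \<Longrightarrow> le_mod \<mu> A (I h) (f \<beta>) (u h)" by auto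
    obtain h where h: "\<And>\<xi>. \<xi> \<in> Field \<rho> \<Longrightarrow> h \<xi> \<in> P"
      "\<And>\<xi> \<xi>'. (\<xi>, \<xi>') \<in> \<rho> \<Longrightarrow> \<xi> \<noteq> \<xi>' \<Longrightarrow> pw_le (u (h \<xi>)) (h \<xi>')"
      by (rule transfinite_iteration[OF \<rho>(1), of P u pw_le])
        (use *(5) pw_bound ordLess_imp_ordLeq in blast)+
    have "(\<lambda>\<xi>. al (h \<xi>)) ` Field \<rho> \<subseteq> Field \<kappa>" using *(1) h(1) by blast
    moreover have "|(\<lambda>\<xi>. al (h \<xi>)) ` Field \<rho>| <o \<kappa>"
      by (rule ordLeq_ordLess_trans[OF card_of_image_Field_ordLeq[OF \<rho>(1)] \<kappa>(2)])
    ultimately have "\<exists>\<gamma>\<in>Field \<kappa>. \<forall>\<alpha>\<in>(\<lambda>\<xi>. al (h \<xi>)) ` Field \<rho>. (\<alpha>, \<gamma>) \<in> \<kappa>"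
      by (rule regular_cardinal_bounded[OF \<kappa>(1)])
    then obtain \<gamma> where \<gamma>: "\<gamma> \<in> Field \<kappa>" "\<And>\<xi>. \<xi> \<in> Field \<rho> \<Longrightarrow> (al (h \<xi>), \<gamma>) \<in> \<kappa>"
      by blast
    \<comment> \<open>As \<open>\<rho> <o \<kappa>\<close>, the index \<open>\<gamma>\<close> is
      past the escape index \<open>al (h \<xi>)\<close> of every stage; \<open>E \<xi>\<close> is
      the part of \<open>A\<close> on which stage \<open>\<xi>\<close> has caught up with
      \<open>f \<gamma>\<close>.\<close>
    define E where "E \<xi> = {a \<in> A. (f \<gamma> a, h \<xi> a) \<in> \<mu>}" for \<xi>
    show False
    proof (rule no_strict_chain_of_subsets[OF \<rho> A_\<rho>, of E])
      show "E \<xi> \<subseteq> A" for \<xi> by (auto simp: E_def)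
      fix \<xi> \<xi>' assume \<xi>: "(\<xi>, \<xi>') \<in> \<rho>" "\<xi> \<noteq> \<xi>'"
      have hP: "h \<xi> \<in> P" and \<xi>F: "\<xi> \<in> Field \<rho>" using h(1) \<xi>(1) by (auto simp: Field_def)
      have "pw_le (h \<xi>) (h \<xi>')" using pw_trans[OF *(6)[OF hP] h(2)[OF \<xi>]] .
      then have "E \<xi> \<subseteq> E \<xi>'"
        using Well_order_trans[OF wo] by (auto simp: E_def)
      moreover have "E \<xi> \<noteq> E \<xi>'"
      proof
        assume eq: "E \<xi> = E \<xi>'"
        note I = *(2)[OF hP]
        \<comment> \<open>Without growth, \<open>h \<xi>\<close> would already bound
          \<open>f \<gamma>\<close>, hence \<open>f (al (h \<xi>))\<close>, modulo
          \<open>I (h \<xi>)\<close>. But that ideal concentrates on the set where this last bound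
          fails, so all of \<open>A\<close> would be null.\<close>
        have "le_mod \<mu> A (I (h \<xi>)) (f \<gamma>) (h \<xi>')"
          using le_mod_trans[OF I *(7)[OF hP \<gamma>(1)] le_mod_pw[OF I h(2)[OF \<xi>]]] .
        then have "A - E \<xi>' \<in> I (h \<xi>)"
          unfolding le_mod_def by (rule proper_idealD(4)[OF I]) (auto simp: E_def)
        then have "le_mod \<mu> A (I (h \<xi>)) (f \<gamma>) (h \<xi>)"
          unfolding le_mod_def eq[symmetric] by (rule proper_idealD(4)[OF I]) (auto simp: E_def)
        moreover have "le_mod \<mu> A (I (h \<xi>)) (f (al (h \<xi>))) (f \<gamma>)"
          using increasing_le_mod[OF J f(1) \<gamma>(2)[OF \<xi>F]] le_mod_mono *(3)[OF hP] by blast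
        ultimately have "le_mod \<mu> A (I (h \<xi>)) (f (al (h \<xi>))) (h \<xi>)"
          using le_mod_trans[OF I] by blast
        then have "{a \<in> A. (f (al (h \<xi>)) a, h \<xi> a) \<notin> \<mu>} \<union>
            (A - {a \<in> A. (f (al (h \<xi>)) a, h \<xi> a) \<notin> \<mu>}) \<in> I (h \<xi>)"
          using proper_idealD(5)[OF I] *(4)[OF hP] unfolding le_mod_def by blast
        moreover have "X \<union> (A - X) = A" if "X \<subseteq> A" for X using that by blast
        ultimately show False using proper_idealD(3)[OF I] by simp
      qed
      ultimately show "E \<xi> \<subset> E \<xi>'" by blast
    qed
  qed
qed

text \<open>Induction on the size \<open>r\<close> of the family: the hypothesis gives directedness
  for families smaller than \<open>r\<close>, and \<open>bdd_of_singular\<close> or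
  \<open>bdd_of_regular\<close> extends it to size \<open>r\<close>.\<close>

lemma bdd_below_least:
  fixes \<kappa> :: "('a \<Rightarrow> 'a) rel"
  assumes J: "proper_ideal_on A J"
    and loc: "\<And>(r::('a \<Rightarrow> 'a) rel) X. Card_order r \<Longrightarrow> r <o \<kappa> \<Longrightarrow> X \<subseteq> A \<Longrightarrow> X \<notin> J \<Longrightarrow>
       \<exists>I. proper_ideal_on A I \<and> J \<subseteq> I \<and> A - X \<in> I \<and> (\<forall>F. F \<subseteq> P \<longrightarrow> |F| \<le>o r \<longrightarrow> bdd I F)"
    and F: "F \<subseteq> P" "|F| <o \<kappa>"
  shows "bdd J F"
proof -
  have "Card_order r \<longrightarrow> r <o \<kappa> \<longrightarrow> (\<forall>F. F \<subseteq> P \<longrightarrow> |F| \<le>o r \<longrightarrow> bdd J F)" for r :: "('a \<Rightarrow> 'a) rel"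
  proof (rule wf_induct[OF wf_ordLess, of _ r])
    fix r :: "('a \<Rightarrow> 'a) rel"
    assume IH: "\<forall>s::('a \<Rightarrow> 'a) rel. s <o r \<longrightarrow> Card_order s \<longrightarrow> s <o \<kappa> \<longrightarrow>
                  (\<forall>F. F \<subseteq> P \<longrightarrow> |F| \<le>o s \<longrightarrow> bdd J F)"
    show "Card_order r \<longrightarrow> r <o \<kappa> \<longrightarrow> (\<forall>F. F \<subseteq> P \<longrightarrow> |F| \<le>o r \<longrightarrow> bdd J F)"
    proof (intro impI allI)
      fix F assume r: "Card_order r" "r <o \<kappa>" and F: "F \<subseteq> P" "|F| \<le>o r"
      have dir: "bdd J G" if "G \<subseteq> P" "|G| <o r" for G
      proof -
        \<comment> \<open>The cardinal \<open>|G|\<close> is itself an order on functions, so it has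
          the type over which the induction runs.\<close>
        have "|G| <o \<kappa>" by (rule ordLess_transitive[OF that(2) r(2)])
        from IH[rule_format, OF that(2) card_of_Card_order this that(1)]
        show ?thesis using ordLeq_reflexive[OF card_of_Well_order] by blast
      qed
      show "bdd J F"
      proof (cases "regularCard r \<and> \<rho> <o r")
        case False
        show ?thesis by (rule bdd_of_singular[OF J r(1) dir False F])
      next
        case True
        then have "infinite (Field r)"
          using card_of_ordLeq_infinite[OF card_of_mono2[OF ordLess_imp_ordLeq] \<rho>(2)] by blast
        then have "regular_cardinal r" using True r(1) by (simp add: regular_cardinal_def)
        then show ?thesis
          by (rule bdd_of_regular[OF J _ conjunct2[OF True] dir loc[OF r] F])
      qed
    qed
  qed
  then show ?thesis
    using F card_of_Card_order ordLeq_reflexive[OF card_of_Well_order] by blast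
qed

text \<open>
  If every increasing sequence failed to be cofinal, each one would be bounded modulo a proper ideal
  over which some family of size \<open>\<kappa>\<close> is unbounded. Iterating \<open>\<rho>\<close> times, comparing all
  the sequences at one late index \<open>\<gamma>\<close> with one common bound \<open>h\<close> would give a strict chain of
  subsets of \<open>A\<close> of length \<open>\<rho>\<close>.
\<close>

lemma has_tcf_of_directed:
  fixes \<kappa> :: "'l rel"
  assumes J: "proper_ideal_on A J" and \<kappa>: "regular_cardinal \<kappa>" "\<rho> <o \<kappa>"
    and dir: "\<And>F. F \<subseteq> P \<Longrightarrow> |F| <o \<kappa> \<Longrightarrow> bdd J F"
    and unb: "\<And>I. proper_ideal_on A I \<Longrightarrow> J \<subseteq> I \<Longrightarrow> \<exists>F. F \<subseteq> P \<and> |F| \<le>o \<kappa> \<and> \<not> bdd I F"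
  shows "has_tcf \<mu> A J \<kappa>"
proof (rule ccontr)
  assume no: "\<not> has_tcf \<mu> A J \<kappa>"
  have co: "Card_order \<kappa>" and inf: "infinite (Field \<kappa>)"
    using \<kappa> by (auto simp: regular_cardinal_def)
  note wo\<kappa> = Card_order_Well_order[OF co]
  define S where "S = {f :: 'l \<Rightarrow> 'a \<Rightarrow> 'a. increasing \<kappa> J f}"
  define R where "R f g \<longleftrightarrow> (\<forall>\<alpha>\<in>Field \<kappa>. pw_le (f \<alpha>) (g \<alpha>))" for f g :: "'l \<Rightarrow> 'a \<Rightarrow> 'a"
  have S_in: "f \<alpha> \<in> P" if "f \<in> S" "\<alpha> \<in> Field \<kappa>" for f \<alpha>
    using that increasing_in[of \<kappa> J f \<alpha>] by (simp add: S_def)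
  have "\<forall>f\<in>S. \<exists>I g u. proper_ideal_on A I \<and> J \<subseteq> I \<and> g \<in> P \<and> (\<forall>\<alpha>\<in>Field \<kappa>. le_mod \<mu> A I (f \<alpha>) g) \<and>
      u \<in> S \<and> R f u \<and> (\<forall>h\<in>P. \<exists>\<alpha>\<in>Field \<kappa>. \<not> le_mod \<mu> A I (u \<alpha>) h)"
  proof
    fix f assume fS: "f \<in> S"
    then have inc: "increasing \<kappa> J f" by (simp add: S_def)
    have "\<not> (\<forall>g\<in>P. \<exists>\<alpha>\<in>Field \<kappa>. le_mod \<mu> A J g (f \<alpha>))"
      using no \<kappa>(1) inc unfolding has_tcf_def increasing_def by blast
    then obtain g where g: "g \<in> P" "\<And>\<alpha>. \<alpha> \<in> Field \<kappa> \<Longrightarrow> \<not> le_mod \<mu> A J g (f \<alpha>)" by blast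
    \<comment> \<open>On the positive set \<open>C \<alpha>\<close> the function \<open>g\<close>
      stays above \<open>f \<alpha>\<close>. These sets shrink modulo \<open>J\<close> as the index
      grows.\<close>
    define C where "C \<alpha> = {a \<in> A. (g a, f \<alpha> a) \<notin> \<mu>}" for \<alpha>
    have CJ: "C \<alpha> \<notin> J" if "\<alpha> \<in> Field \<kappa>" for \<alpha>
      using g(2)[OF that] by (simp add: C_def le_mod_def)
    have Cdec: "C \<beta> - C \<alpha> \<in> J" if "(\<alpha>, \<beta>) \<in> \<kappa>" for \<alpha> \<beta>
      using increasing_le_mod[OF J inc that] unfolding le_mod_def
      by (rule proper_idealD(4)[OF J]) (use Well_order_trans[OF wo] in \<open>auto simp: C_def\<close>)
    \<comment> \<open>The union of the ideals concentrated on the sets \<open>C \<alpha>\<close>.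
      They increase with \<alpha>, so the union is an ideal, and it is proper because every
      \<open>C \<alpha>\<close> is positive.\<close>
    define I where "I = {X. X \<subseteq> A \<and> (\<exists>\<alpha>\<in>Field \<kappa>. X \<inter> C \<alpha> \<in> J)}"
    have I_late: "X \<inter> C \<beta> \<in> J" if "X \<inter> C \<alpha> \<in> J" "(\<alpha>, \<beta>) \<in> \<kappa>" for X \<alpha> \<beta>
      using proper_idealD(5)[OF J that(1) Cdec[OF that(2)]]
      by (rule proper_idealD(4)[OF J]) blast
    obtain \<alpha>0 where \<alpha>0: "\<alpha>0 \<in> Field \<kappa>" using inf by fastforce
    have IJ: "J \<subseteq> I"
    proof
      fix X assume X: "X \<in> J"
      then have "X \<inter> C \<alpha>0 \<in> J" by (rule proper_idealD(4)[OF J]) blast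
      then show "X \<in> I" using X \<alpha>0 proper_idealD(1)[OF J] unfolding I_def by blast
    qed
    have I: "proper_ideal_on A I"
      unfolding proper_ideal_on_def
    proof (intro conjI ballI allI impI)
      show "I \<subseteq> Pow A" by (auto simp: I_def)
      show "{} \<in> I" using IJ proper_idealD(2)[OF J] by blast
      have "A \<inter> C \<alpha> = C \<alpha>" for \<alpha> by (auto simp: C_def)
      then show "A \<notin> I" using CJ by (auto simp: I_def)
      show "Y \<in> I" if XY: "X \<in> I" "Y \<subseteq> X" for X Y
      proof -
        obtain \<alpha> where \<alpha>: "\<alpha> \<in> Field \<kappa>" "X \<inter> C \<alpha> \<in> J" and XA: "X \<subseteq> A"
          using XY(1) unfolding I_def by blast
        have "Y \<inter> C \<alpha> \<in> J" using \<alpha>(2) by (rule proper_idealD(4)[OF J]) (use XY(2) in blast)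
        then show ?thesis using \<alpha>(1) XY(2) XA unfolding I_def by blast
      qed
      fix X Y assume "X \<in> I" "Y \<in> I"
      then obtain \<alpha> \<beta> where *: "X \<subseteq> A" "\<alpha> \<in> Field \<kappa>" "X \<inter> C \<alpha> \<in> J"
        "Y \<subseteq> A" "\<beta> \<in> Field \<kappa>" "Y \<inter> C \<beta> \<in> J" unfolding I_def by blast
      obtain \<gamma> where \<gamma>: "\<gamma> \<in> Field \<kappa>" "X \<inter> C \<gamma> \<in> J" "Y \<inter> C \<gamma> \<in> J"
        using Well_order_total[OF wo\<kappa> *(2,5)] I_late[OF *(3)] I_late[OF *(6)] * by blast
      have "(X \<union> Y) \<inter> C \<gamma> \<in> J"
        using proper_idealD(5)[OF J \<gamma>(2,3)] by (simp add: Int_Un_distrib2)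
      then show "X \<union> Y \<in> I" using * \<gamma>(1) unfolding I_def by blast
    qed
    have fg: "le_mod \<mu> A I (f \<alpha>) g" if \<alpha>: "\<alpha> \<in> Field \<kappa>" for \<alpha>
    proof -
      have "{a \<in> A. (f \<alpha> a, g a) \<notin> \<mu>} \<inter> C \<alpha> = {}"
        using Well_order_total[OF wo P_Field[OF g(1)] P_Field[OF S_in[OF fS \<alpha>]]]
        by (auto simp: C_def)
      then have "{a \<in> A. (f \<alpha> a, g a) \<notin> \<mu>} \<inter> C \<alpha> \<in> J"
        using proper_idealD(2)[OF J] by (rule ssubst)
      then show ?thesis
        using \<alpha> unfolding le_mod_def I_def by blast
    qed
    \<comment> \<open>Modulo \<open>I\<close> the sequence \<open>f\<close> is bounded by
      \<open>g\<close>, but \<open>unb\<close> yields a family that is not. An increasing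
      \<open>u\<close> pointwise above both that family and \<open>f\<close> is therefore unbounded
      modulo \<open>I\<close>.\<close>
    obtain F where F: "F \<subseteq> P" "|F| \<le>o \<kappa>" "\<not> bdd I F" using unb[OF I IJ] by blast
    have "F \<noteq> {}" using F(3) g(1) unfolding bdd_def by blast
    then obtain e where e: "e ` Field \<kappa> = F" using ordLeq_enumeration[OF co _ F(2)] by blast
    have "\<exists>p. \<forall>\<alpha>\<in>Field \<kappa>. p \<alpha> \<in> P \<and> pw_le (f \<alpha>) (p \<alpha>) \<and> pw_le (e \<alpha>) (p \<alpha>)"
    proof (rule bchoice, rule ballI)
      fix \<alpha> assume \<alpha>: "\<alpha> \<in> Field \<kappa>"
      then have "e \<alpha> \<in> P" using e F(1) by blast
      from pw_max[OF S_in[OF fS \<alpha>] this]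
      show "\<exists>p. p \<in> P \<and> pw_le (f \<alpha>) p \<and> pw_le (e \<alpha>) p" by blast
    qed
    then obtain p where p: "\<forall>\<alpha>\<in>Field \<kappa>. p \<alpha> \<in> P \<and> pw_le (f \<alpha>) (p \<alpha>) \<and> pw_le (e \<alpha>) (p \<alpha>)" ..
    obtain u where u: "increasing \<kappa> J u" "\<And>\<alpha>. \<alpha> \<in> Field \<kappa> \<Longrightarrow> pw_le (p \<alpha>) (u \<alpha>)"
      by (rule increasing_dominating[OF J co dir, of p]) (use p in blast)+
    have "u \<in> S" using u(1) by (simp add: S_def)
    moreover have "R f u"
      unfolding R_def using p u(2) pw_trans by blast
    moreover have "\<exists>\<alpha>\<in>Field \<kappa>. \<not> le_mod \<mu> A I (u \<alpha>) h" if h: "h \<in> P" for h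
    proof -
      obtain \<alpha> where \<alpha>: "\<alpha> \<in> Field \<kappa>" "\<not> le_mod \<mu> A I (e \<alpha>) h"
        using F(3) h e unfolding bdd_def by blast
      have "pw_le (e \<alpha>) (u \<alpha>)" using p u(2) \<alpha>(1) pw_trans by blast
      then have "le_mod \<mu> A I (e \<alpha>) (u \<alpha>)" by (rule le_mod_pw[OF I])
      then show ?thesis using \<alpha> le_mod_trans[OF I] by blast
    qed
    ultimately show "\<exists>I g u. proper_ideal_on A I \<and> J \<subseteq> I \<and> g \<in> P \<and>
      (\<forall>\<alpha>\<in>Field \<kappa>. le_mod \<mu> A I (f \<alpha>) g) \<and>
      u \<in> S \<and> R f u \<and> (\<forall>h\<in>P. \<exists>\<alpha>\<in>Field \<kappa>. \<not> le_mod \<mu> A I (u \<alpha>) h)"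
      using I IJ g(1) fg by (intro exI[of _ I] exI[of _ g] exI[of _ u] conjI ballI) simp_all
  qed
  then obtain I g u where "\<forall>f\<in>S. proper_ideal_on A (I f) \<and> J \<subseteq> I f \<and> g f \<in> P \<and>
      (\<forall>\<alpha>\<in>Field \<kappa>. le_mod \<mu> A (I f) (f \<alpha>) (g f)) \<and>
      u f \<in> S \<and> R f (u f) \<and> (\<forall>h\<in>P. \<exists>\<alpha>\<in>Field \<kappa>. \<not> le_mod \<mu> A (I f) (u f \<alpha>) h)"
    unfolding bchoice_iff by (elim exE)
  then have I: "\<And>f. f \<in> S \<Longrightarrow> proper_ideal_on A (I f)" and IJ: "\<And>f. f \<in> S \<Longrightarrow> J \<subseteq> I f"
    and g: "\<And>f. f \<in> S \<Longrightarrow> g f \<in> P"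
    and fg: "\<And>f \<alpha>. f \<in> S \<Longrightarrow> \<alpha> \<in> Field \<kappa> \<Longrightarrow> le_mod \<mu> A (I f) (f \<alpha>) (g f)"
    and u: "\<And>f. f \<in> S \<Longrightarrow> u f \<in> S" "\<And>f. f \<in> S \<Longrightarrow> R f (u f)"
    and ub: "\<And>f h. f \<in> S \<Longrightarrow> h \<in> P \<Longrightarrow> \<exists>\<alpha>\<in>Field \<kappa>. \<not> le_mod \<mu> A (I f) (u f \<alpha>) h"
    by auto
  \<comment> \<open>Fewer than \<open>\<rho>\<close> sequences are bounded pointwise at each index;
    the result is then dominated by a sequence increasing modulo \<open>J\<close>.\<close>
  have ubS: "\<exists>s\<in>S. \<forall>t\<in>T. R t s" if T: "T \<subseteq> S" "|T| <o \<rho>" for T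
  proof -
    have "\<exists>p. \<forall>\<alpha>\<in>Field \<kappa>. p \<alpha> \<in> P \<and> (\<forall>t\<in>T. pw_le (t \<alpha>) (p \<alpha>))"
    proof (rule bchoice, rule ballI)
      fix \<alpha> assume \<alpha>: "\<alpha> \<in> Field \<kappa>"
      have "(\<lambda>t. t \<alpha>) ` T \<subseteq> P" using T(1) S_in \<alpha> by blast
      moreover have "|(\<lambda>t. t \<alpha>) ` T| \<le>o \<rho>"
        by (rule ordLeq_transitive[OF card_of_image ordLess_imp_ordLeq[OF T(2)]])
      ultimately have "\<exists>g\<in>P. \<forall>f\<in>(\<lambda>t. t \<alpha>) ` T. pw_le f g" by (rule pw_bound)
      then show "\<exists>p. p \<in> P \<and> (\<forall>t\<in>T. pw_le (t \<alpha>) p)" by blast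
    qed
    then obtain p where p: "\<forall>\<alpha>\<in>Field \<kappa>. p \<alpha> \<in> P \<and> (\<forall>t\<in>T. pw_le (t \<alpha>) (p \<alpha>))" ..
    obtain s where s: "increasing \<kappa> J s" "\<And>\<alpha>. \<alpha> \<in> Field \<kappa> \<Longrightarrow> pw_le (p \<alpha>) (s \<alpha>)"
      by (rule increasing_dominating[OF J co dir, of p]) (use p in blast)+
    have "R t s" if "t \<in> T" for t
      unfolding R_def using p s(2) that pw_trans by blast
    then show ?thesis using s(1) unfolding S_def by blast
  qed
  obtain f where f: "\<And>\<xi>. \<xi> \<in> Field \<rho> \<Longrightarrow> f \<xi> \<in> S"
    "\<And>\<xi> \<xi>'. (\<xi>, \<xi>') \<in> \<rho> \<Longrightarrow> \<xi> \<noteq> \<xi>' \<Longrightarrow> R (u (f \<xi>)) (f \<xi>')"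
    by (rule transfinite_iteration[OF \<rho>(1), of S u R]) (use u(1) ubS in blast)+
  \<comment> \<open>One \<open>h\<close> absorbs all the bounds \<open>g (f \<xi>)\<close>, while
    each \<open>u (f \<xi>)\<close> escapes this same \<open>h\<close> at some index
    \<open>al \<xi>\<close>.\<close>
  have "(\<lambda>\<xi>. g (f \<xi>)) ` Field \<rho> \<subseteq> P" using f(1) g by blast
  from pw_bound[OF this card_of_image_Field_ordLeq[OF \<rho>(1)]]
  obtain h where h: "h \<in> P" "\<And>\<xi>. \<xi> \<in> Field \<rho> \<Longrightarrow> pw_le (g (f \<xi>)) h" by blast
  have "\<forall>\<xi>\<in>Field \<rho>. \<exists>\<alpha>. \<alpha> \<in> Field \<kappa> \<and> \<not> le_mod \<mu> A (I (f \<xi>)) (u (f \<xi>) \<alpha>) h"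
    using ub[OF f(1) h(1)] by blast
  then obtain al where al: "\<And>\<xi>. \<xi> \<in> Field \<rho> \<Longrightarrow> al \<xi> \<in> Field \<kappa>"
    "\<And>\<xi>. \<xi> \<in> Field \<rho> \<Longrightarrow> \<not> le_mod \<mu> A (I (f \<xi>)) (u (f \<xi>) (al \<xi>)) h"
    unfolding bchoice_iff by blast
  have "al ` Field \<rho> \<subseteq> Field \<kappa>" using al(1) by blast
  moreover have "|al ` Field \<rho>| <o \<kappa>"
    by (rule ordLeq_ordLess_trans[OF card_of_image_Field_ordLeq[OF \<rho>(1)] \<kappa>(2)])
  ultimately have "\<exists>\<gamma>\<in>Field \<kappa>. \<forall>\<alpha>\<in>al ` Field \<rho>. (\<alpha>, \<gamma>) \<in> \<kappa>"
    by (rule regular_cardinal_bounded[OF \<kappa>(1)])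
  then obtain \<gamma> where \<gamma>: "\<gamma> \<in> Field \<kappa>" "\<And>\<xi>. \<xi> \<in> Field \<rho> \<Longrightarrow> (al \<xi>, \<gamma>) \<in> \<kappa>"
    by blast
  define E where "E \<xi> = {a \<in> A. (f \<xi> \<gamma> a, h a) \<notin> \<mu>}" for \<xi>
  show False
  proof (rule no_strict_chain_of_subsets[OF \<rho> A_\<rho>, of E])
    show "E \<xi> \<subseteq> A" for \<xi> by (auto simp: E_def)
    fix \<xi> \<xi>' assume \<xi>: "(\<xi>, \<xi>') \<in> \<rho>" "\<xi> \<noteq> \<xi>'"
    have fS: "f \<xi> \<in> S" and \<xi>F: "\<xi> \<in> Field \<rho>" using f(1) \<xi>(1) by (auto simp: Field_def)
    note If = I[OF fS]
    have uf: "pw_le (u (f \<xi>) \<gamma>) (f \<xi>' \<gamma>)" using f(2)[OF \<xi>] \<gamma>(1) by (simp add: R_def)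
    have "pw_le (f \<xi> \<gamma>) (u (f \<xi>) \<gamma>)" using u(2)[OF fS] \<gamma>(1) by (simp add: R_def)
    from pw_trans[OF this uf] have "E \<xi> \<subseteq> E \<xi>'"
      using Well_order_trans[OF wo] by (auto simp: E_def)
    moreover have "E \<xi> \<noteq> E \<xi>'"
    proof
      assume eq: "E \<xi> = E \<xi>'"
      \<comment> \<open>Without growth, the bound \<open>h\<close> would pass from
        \<open>f \<xi>\<close> to \<open>f \<xi>'\<close> at index \<open>\<gamma>\<close>, and from
        there down to \<open>u (f \<xi>)\<close>, against the choice of
        \<open>al \<xi>\<close>.\<close>
      have "le_mod \<mu> A (I (f \<xi>)) (f \<xi> \<gamma>) h"
        using le_mod_trans[OF If fg[OF fS \<gamma>(1)] le_mod_pw[OF If h(2)[OF \<xi>F]]] .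
      then have "le_mod \<mu> A (I (f \<xi>)) (f \<xi>' \<gamma>) h"
        using eq unfolding le_mod_def E_def by simp
      then have "le_mod \<mu> A (I (f \<xi>)) (u (f \<xi>) \<gamma>) h"
        using le_mod_trans[OF If le_mod_pw[OF If uf]] by blast
      moreover have "increasing \<kappa> J (u (f \<xi>))" using u(1)[OF fS] by (simp add: S_def)
      from le_mod_mono[OF increasing_le_mod[OF J this \<gamma>(2)[OF \<xi>F]] IJ[OF fS]]
      have "le_mod \<mu> A (I (f \<xi>)) (u (f \<xi>) (al \<xi>)) (u (f \<xi>) \<gamma>)" .
      ultimately show False using le_mod_trans[OF If] al(2)[OF \<xi>F] by blast
    qed
    ultimately show "E \<xi> \<subset> E \<xi>'" by blast
  qed
qed

theorem ex_concentrated_tcf: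
  assumes J: "proper_ideal_on A J"
  shows "\<exists>B (\<kappa>::('a \<Rightarrow> 'a) rel). B \<subseteq> A \<and> B \<notin> J \<and> has_tcf \<mu> A (concentrate A J B) \<kappa>"
proof -
  \<comment> \<open>Quantifying over all proper extensions makes \<open>Q B \<kappa>\<close> the
    hypothesis \<open>unb\<close> of \<open>has_tcf_of_directed\<close>, while failure of
    \<open>Q\<close> at a smaller cardinal is the local boundedness asked for by
    \<open>bdd_below_least\<close>.\<close>
  define Q where "Q B r \<longleftrightarrow> (\<forall>I. proper_ideal_on A I \<longrightarrow> concentrate A J B \<subseteq> I \<longrightarrow>
      (\<exists>F. F \<subseteq> P \<and> |F| \<le>o r \<and> \<not> bdd I F))" for B and r :: "('a \<Rightarrow> 'a) rel"
  let ?R = "{r. Card_order r \<and> (\<exists>B. B \<subseteq> A \<and> B \<notin> J \<and> Q B r)}"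
  have "Q A |P|"
    unfolding Q_def using not_bdd_P ordLeq_reflexive[OF card_of_Well_order] by blast
  then have "|P| \<in> ?R"
    using proper_idealD(3)[OF J] card_of_Card_order by blast
  then have "\<exists>r\<in>?R. \<forall>r'\<in>?R. r \<le>o r'"
    by (intro exists_minim_Card_order) auto
  then obtain \<kappa> B where \<kappa>: "Card_order \<kappa>" and B: "B \<subseteq> A" "B \<notin> J" and QB: "Q B \<kappa>"
    and least: "\<forall>r'\<in>?R. \<kappa> \<le>o r'" by blast
  let ?J = "concentrate A J B"
  have pJ: "proper_ideal_on A ?J" by (rule proper_ideal_concentrate[OF J B])
  have dir: "bdd ?J F" if "F \<subseteq> P" "|F| <o \<kappa>" for F
  proof (rule bdd_below_least[OF pJ _ that])
    fix r :: "('a \<Rightarrow> 'a) rel" and X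
    assume r: "Card_order r" "r <o \<kappa>" and X: "X \<subseteq> A" "X \<notin> ?J"
    have XB: "X \<inter> B \<subseteq> A" "X \<inter> B \<notin> J" using X by (auto simp: concentrate_def)
    \<comment> \<open>Leastness is applied to the positive set \<open>X \<inter> B\<close>; the
      ideal refuting \<open>Q\<close> there contains both \<open>?J\<close> and
      \<open>A - X\<close>.\<close>
    have "\<not> Q (X \<inter> B) r"
      using least r XB not_ordLess_ordLeq by blast
    then obtain I where I: "proper_ideal_on A I" "concentrate A J (X \<inter> B) \<subseteq> I"
      "\<forall>F. F \<subseteq> P \<longrightarrow> |F| \<le>o r \<longrightarrow> bdd I F" unfolding Q_def by blast
    have "Y \<inter> (X \<inter> B) \<in> J" if "Y \<inter> B \<in> J" for Y
      using that by (rule proper_idealD(4)[OF J]) blast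
    then have "?J \<subseteq> concentrate A J (X \<inter> B)" by (auto simp: concentrate_def)
    moreover have "(A - X) \<inter> (X \<inter> B) = {}" by blast
    then have "A - X \<in> concentrate A J (X \<inter> B)"
      using proper_idealD(2)[OF J] by (simp add: concentrate_def)
    ultimately show "\<exists>I. proper_ideal_on A I \<and> ?J \<subseteq> I \<and> A - X \<in> I \<and>
        (\<forall>F. F \<subseteq> P \<longrightarrow> |F| \<le>o r \<longrightarrow> bdd I F)" using I by blast
  qed
  have unb: "\<exists>F. F \<subseteq> P \<and> |F| \<le>o \<kappa> \<and> \<not> bdd I F" if "proper_ideal_on A I" "?J \<subseteq> I" for I
    using QB that unfolding Q_def by blast
  \<comment> \<open>Otherwise \<open>bdd_of_singular\<close> would bound every family of size at
    most \<open>\<kappa>\<close> modulo \<open>?J\<close>, against \<open>unb\<close>.\<close>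
  have reg: "regularCard \<kappa> \<and> \<rho> <o \<kappa>"
    using bdd_of_singular[OF pJ \<kappa> dir] unb[OF pJ] by blast
  then have "infinite (Field \<kappa>)"
    using card_of_ordLeq_infinite[OF card_of_mono2[OF ordLess_imp_ordLeq] \<rho>(2)] by blast
  then have "regular_cardinal \<kappa>" using reg \<kappa> by (simp add: regular_cardinal_def)
  from has_tcf_of_directed[OF pJ this conjunct2[OF reg] dir unb] B
  show ?thesis by blast
qed

end

section \<open>Amalgamating ideals along a cofinal set\<close>

text \<open>Each \<open>|B k|\<close> is the size of an initial segment of \<open>\<theta>\<close>.
  Fewer than \<open>cf \<theta>\<close> endpoints have a common bound \<open>y\<close>, so one
  segment is as large as every \<open>B k\<close>, and its disjoint sum with \<open>K\<close> bounds
  the union.\<close>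

lemma card_of_UNION_ordLess_cf:
  assumes \<theta>: "Card_order \<theta>" "infinite (Field \<theta>)"
    and K: "infinite K" "|K| <o cf \<theta>" "|K| <o \<theta>"
    and B: "\<And>k. k \<in> K \<Longrightarrow> |B k| <o \<theta>"
  shows "|\<Union>k\<in>K. B k| <o \<theta>"
proof -
  note wo = Card_order_Well_order[OF \<theta>(1)]
  have "\<forall>k\<in>K. \<exists>x. x \<in> Field \<theta> \<and> |B k| =o |underS \<theta> x|"
  proof
    fix k assume "k \<in> K"
    from B[OF this] obtain x where x: "x \<in> Field \<theta>" "|B k| =o Restr \<theta> (underS \<theta> x)"
      using ordLess_iff_ordIso_Restr[OF wo card_of_Well_order] by blast
    from card_of_cong[OF x(2)] have "|B k| =o |underS \<theta> x|"
      using Field_ord_of[OF wo, of x] by (simp add: ord_of_def Field_card_of)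
    with x(1) show "\<exists>x. x \<in> Field \<theta> \<and> |B k| =o |underS \<theta> x|" by blast
  qed
  then obtain x where x: "\<forall>k\<in>K. x k \<in> Field \<theta> \<and> |B k| =o |underS \<theta> (x k)|"
    unfolding bchoice_iff by (elim exE)
  have "x ` K \<subseteq> Field \<theta>" using x by blast
  from less_cf_bounded[OF \<theta> this ordLeq_ordLess_trans[OF card_of_image K(2)]]
  obtain y where y: "y \<in> Field \<theta>" "\<And>k. k \<in> K \<Longrightarrow> (x k, y) \<in> \<theta>" by blast
  let ?M = "K <+> underS \<theta> y"
  have M: "|?M| <o \<theta>"
    by (rule card_of_Plus_ordLess_infinite_Field[OF \<theta>(2,1) K(3) card_of_underS[OF \<theta>(1) y(1)]])
  have "|\<Union>k\<in>K. B k| \<le>o |?M|"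
  proof (rule card_of_UNION_ordLeq_infinite)
    show "infinite ?M" using K(1) by simp
    show "|K| \<le>o |?M|" by (rule card_of_Plus1)
    show "\<forall>k\<in>K. |B k| \<le>o |?M|"
    proof
      fix k assume k: "k \<in> K"
      have "underS \<theta> (x k) \<subseteq> underS \<theta> y"
        using y(2)[OF k] Well_order_trans[OF wo] Well_order_antisym[OF wo]
        unfolding underS_def by blast
      from ordLeq_transitive[OF card_of_mono1[OF this] card_of_Plus2]
      show "|B k| \<le>o |?M|" using x k ordIso_ordLeq_trans by blast
    qed
  qed
  from ordLeq_ordLess_trans[OF this M] show ?thesis .
qed

lemma ord_of_strict_mono:
  assumes "Well_order \<mu>" "(z, a) \<in> \<mu>" "z \<noteq> a"
  shows "ord_of \<mu> z <o ord_of \<mu> a"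
proof -
  have wr: "wo_rel \<mu>" using assms(1) by (simp add: wo_rel_def)
  have "underS \<mu> z \<subset> underS \<mu> a"
    using assms Well_order_trans[OF assms(1)] Well_order_antisym[OF assms(1)]
    unfolding underS_def by blast
  then show ?thesis
    unfolding ord_of_def
    using ofilter_subset_ordLess[OF assms(1) wo_rel.underS_ofilter[OF wr] wo_rel.underS_ofilter[OF wr]]
    by blast
qed

text \<open>Each member of \<open>T\<close> lies below some term of the cofinal sequence, and fewer
  than \<open>\<kappa>\<close> indices are bounded by regularity.\<close>

lemma has_tcf_bounded:
  fixes \<kappa> :: "'l rel"
  assumes wo: "Well_order \<mu>" and J: "proper_ideal_on A J" and tcf: "has_tcf \<mu> A J \<kappa>"
    and T: "T \<subseteq> Prod \<mu> A" "|T| <o \<kappa>"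
  shows "\<exists>g\<in>Prod \<mu> A. \<forall>f\<in>T. le_mod \<mu> A J f g"
proof -
  obtain F where reg: "regular_cardinal \<kappa>" and F: "\<forall>\<alpha>\<in>Field \<kappa>. F \<alpha> \<in> Prod \<mu> A"
    and inc: "\<forall>\<alpha> \<beta>. \<alpha> \<noteq> \<beta> \<and> (\<alpha>, \<beta>) \<in> \<kappa> \<longrightarrow> less_mod \<mu> A J (F \<alpha>) (F \<beta>)"
    and cof: "\<forall>g\<in>Prod \<mu> A. \<exists>\<alpha>. \<alpha> \<in> Field \<kappa> \<and> le_mod \<mu> A J g (F \<alpha>)"
    using tcf unfolding has_tcf_def Bex_def by blast
  have \<kappa>: "Card_order \<kappa>" "infinite (Field \<kappa>)" using reg by (auto simp: regular_cardinal_def)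
  note wo\<kappa> = Card_order_Well_order[OF \<kappa>(1)]
  from cof obtain al where al: "\<forall>g\<in>Prod \<mu> A. al g \<in> Field \<kappa> \<and> le_mod \<mu> A J g (F (al g))"
    unfolding bchoice_iff by (elim exE)
  have "al ` T \<subseteq> Field \<kappa>" using al T(1) by blast
  from regular_cardinal_bounded[OF reg this ordLeq_ordLess_trans[OF card_of_image T(2)]]
  obtain \<gamma> where \<gamma>: "\<gamma> \<in> Field \<kappa>" "\<And>f. f \<in> T \<Longrightarrow> (al f, \<gamma>) \<in> \<kappa>" by blast
  \<comment> \<open>Going strictly past \<open>\<gamma>\<close> keeps every \<open>al f\<close>
    different from \<open>\<delta>\<close>, since \<open>inc\<close> speaks of distinct
    indices.\<close>
  obtain \<delta> where \<delta>: "\<delta> \<in> Field \<kappa>" "\<gamma> \<noteq> \<delta>" "(\<gamma>, \<delta>) \<in> \<kappa>"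
    using infinite_Card_order_limit[OF \<kappa> \<gamma>(1)] by blast
  have "le_mod \<mu> A J f (F \<delta>)" if f: "f \<in> T" for f
  proof -
    have "(al f, \<delta>) \<in> \<kappa>" by (rule Well_order_trans[OF wo\<kappa> \<gamma>(2)[OF f] \<delta>(3)])
    moreover have "al f \<noteq> \<delta>"
      using Well_order_antisym[OF wo\<kappa> \<gamma>(2)[OF f]] \<delta>(2,3) by metis
    ultimately have "less_mod \<mu> A J (F (al f)) (F \<delta>)" using inc by blast
    from le_mod_transitive[OF wo J _ less_mod_le_mod[OF J this]]
    show ?thesis using al f T(1) by blast
  qed
  then show ?thesis using F \<delta>(1) by blast
qed

text \<open>Only a tail of \<open>K\<close> is tested, so when the \<open>J \<eta>\<close> are
  ideals and every \<open>B \<eta>\<close> lies above \<open>\<eta>\<close>, all bounded subsets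
  belong to the ideal.\<close>

definition eventual_ideal ::
    "'a rel \<Rightarrow> 'a set \<Rightarrow> ('a \<Rightarrow> 'a set) \<Rightarrow> ('a \<Rightarrow> 'a set set) \<Rightarrow> 'a set set" where
  "eventual_ideal \<mu> K B J = {X. X \<subseteq> (\<Union>\<eta>\<in>K. B \<eta>) \<and>
     (\<exists>x\<in>Field \<mu>. \<forall>\<eta>\<in>K. (x, \<eta>) \<in> \<mu> \<and> x \<noteq> \<eta> \<longrightarrow> X \<inter> B \<eta> \<in> J \<eta>)}"

text \<open>Fewer than \<open>\<sigma>\<close> thresholds have a common bound because
  \<open>\<sigma> \<le>o cf \<mu>\<close>, and past it the completeness of each
  \<open>J \<eta>\<close> applies. Properness holds because no tail of the cofinal set
  \<open>K\<close> is empty and each \<open>B \<eta>\<close> is positive.\<close>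

lemma complete_eventual_ideal:
  assumes \<mu>: "Card_order \<mu>" "infinite (Field \<mu>)" and K: "K \<subseteq> Field \<mu>" "cofinal K \<mu>"
    and \<sigma>: "infinite (Field \<sigma>)" "Card_order \<sigma>" "\<sigma> \<le>o cf \<mu>"
    and J: "\<And>\<eta>. \<eta> \<in> K \<Longrightarrow> complete_ideal_on \<sigma> (A \<eta>) (J \<eta>)"
    and B: "\<And>\<eta>. \<eta> \<in> K \<Longrightarrow> B \<eta> \<notin> J \<eta>"
  shows "complete_ideal_on \<sigma> (\<Union>\<eta>\<in>K. B \<eta>) (eventual_ideal \<mu> K B J)"
    (is "complete_ideal_on \<sigma> ?U ?J")
proof -
  note wo = Card_order_Well_order[OF \<mu>(1)]
  have pJ: "proper_ideal_on (A \<eta>) (J \<eta>)" if "\<eta> \<in> K" for \<eta>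
    using J[OF that] by (simp add: complete_ideal_on_def)
  have sigma: "\<Union>S \<in> ?J" if S: "S \<subseteq> ?J" "|S| <o \<sigma>" for S
  proof -
    have "\<forall>X\<in>S. \<exists>x. x \<in> Field \<mu> \<and> (\<forall>\<eta>\<in>K. (x, \<eta>) \<in> \<mu> \<and> x \<noteq> \<eta> \<longrightarrow> X \<inter> B \<eta> \<in> J \<eta>)"
      using S(1) unfolding eventual_ideal_def by blast
    then obtain x where x: "\<forall>X\<in>S. x X \<in> Field \<mu> \<and>
        (\<forall>\<eta>\<in>K. (x X, \<eta>) \<in> \<mu> \<and> x X \<noteq> \<eta> \<longrightarrow> X \<inter> B \<eta> \<in> J \<eta>)"
      unfolding bchoice_iff by (elim exE)
    have "x ` S \<subseteq> Field \<mu>" using x by blast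
    from less_cf_bounded[OF \<mu> this
        ordLeq_ordLess_trans[OF card_of_image ordLess_ordLeq_trans[OF S(2) \<sigma>(3)]]]
    obtain y where y: "y \<in> Field \<mu>" "\<And>X. X \<in> S \<Longrightarrow> (x X, y) \<in> \<mu>" by blast
    have "\<Union>S \<inter> B \<eta> \<in> J \<eta>" if \<eta>: "\<eta> \<in> K" "(y, \<eta>) \<in> \<mu>" "y \<noteq> \<eta>" for \<eta>
    proof -
      have "X \<inter> B \<eta> \<in> J \<eta>" if X: "X \<in> S" for X
      proof -
        have "(x X, \<eta>) \<in> \<mu>" by (rule Well_order_trans[OF wo y(2)[OF X] \<eta>(2)])
        moreover have "x X \<noteq> \<eta>" using Well_order_antisym[OF wo y(2)[OF X]] \<eta>(2,3) by metis
        ultimately show ?thesis using x X \<eta>(1) by blast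
      qed
      then have "(\<lambda>X. X \<inter> B \<eta>) ` S \<subseteq> J \<eta>" by blast
      moreover have "|(\<lambda>X. X \<inter> B \<eta>) ` S| <o \<sigma>" by (rule ordLeq_ordLess_trans[OF card_of_image S(2)])
      ultimately have "\<Union>((\<lambda>X. X \<inter> B \<eta>) ` S) \<in> J \<eta>"
        using J[OF \<eta>(1)] unfolding complete_ideal_on_def by blast
      moreover have "\<Union>((\<lambda>X. X \<inter> B \<eta>) ` S) = \<Union>S \<inter> B \<eta>" by blast
      ultimately show ?thesis by simp
    qed
    moreover have "\<Union>S \<subseteq> ?U" using S(1) unfolding eventual_ideal_def by blast
    ultimately show ?thesis using y(1) unfolding eventual_ideal_def by blast
  qed
  have fin: "|S| <o \<sigma>" if "finite S" for S :: "'a set set"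
    using that \<sigma> Card_order_Well_order card_of_Well_order
    by (intro finite_ordLess_infinite) (auto simp: Field_card_of)
  have "proper_ideal_on ?U ?J"
    unfolding proper_ideal_on_def
  proof (intro conjI ballI allI impI)
    show "?J \<subseteq> Pow ?U" by (auto simp: eventual_ideal_def)
    show "{} \<in> ?J" using sigma[of "{}"] fin[of "{}"] by simp
    show "X \<union> Y \<in> ?J" if "X \<in> ?J" "Y \<in> ?J" for X Y
      using sigma[of "{X, Y}"] fin[of "{X, Y}"] that by simp
    show "Y \<in> ?J" if XY: "X \<in> ?J" "Y \<subseteq> X" for X Y
    proof -
      obtain x where x: "x \<in> Field \<mu>" "\<forall>\<eta>\<in>K. (x, \<eta>) \<in> \<mu> \<and> x \<noteq> \<eta> \<longrightarrow> X \<inter> B \<eta> \<in> J \<eta>"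
        and XU: "X \<subseteq> ?U"
        using XY(1) unfolding eventual_ideal_def by blast
      have "Y \<inter> B \<eta> \<in> J \<eta>" if "\<eta> \<in> K" "(x, \<eta>) \<in> \<mu>" "x \<noteq> \<eta>" for \<eta>
      proof (rule proper_idealD(4)[OF pJ[OF that(1)]])
        show "X \<inter> B \<eta> \<in> J \<eta>" using x(2) that by blast
      qed (use XY(2) in blast)
      then show ?thesis using x(1) XU XY(2) unfolding eventual_ideal_def by blast
    qed
    show "?U \<notin> ?J"
    proof
      assume "?U \<in> ?J"
      then obtain x where x: "x \<in> Field \<mu>" "\<forall>\<eta>\<in>K. (x, \<eta>) \<in> \<mu> \<and> x \<noteq> \<eta> \<longrightarrow> ?U \<inter> B \<eta> \<in> J \<eta>"
        unfolding eventual_ideal_def by blast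
      obtain \<eta> where \<eta>: "\<eta> \<in> K" "x \<noteq> \<eta>" "(x, \<eta>) \<in> \<mu>"
        using K(2) x(1) unfolding cofinal_def by blast
      have "?U \<inter> B \<eta> = B \<eta>" using \<eta>(1) by blast
      moreover have "?U \<inter> B \<eta> \<in> J \<eta>" using x(2) \<eta> by blast
      ultimately show False using B[OF \<eta>(1)] by simp
    qed
  qed
  then show ?thesis using sigma unfolding complete_ideal_on_def by blast
qed

section \<open>Comparison of pcf with pp below a singular cardinal\<close>

theorem theorem4p2:
  fixes \<mu> :: "'a rel" and \<sigma> :: "'s rel" and \<theta> :: "'t rel"
  assumes "singular_cardinal \<mu>"
    and "regular_cardinal \<sigma>" and "Card_order \<theta>"
    and "natLeq \<le>o \<sigma>" and "\<sigma> \<le>o cf \<mu>" and "cf \<mu> <o cf \<theta>" and "cf \<theta> \<le>o \<theta>" and "\<theta> <o \<mu>"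
  shows "\<exists>\<eta>\<in>Field \<mu>. \<forall>A. A \<subseteq> {a \<in> Reg_below \<mu>. (\<eta>, a) \<in> \<mu>} \<and> progressive \<mu> A \<longrightarrow>
           card_sup (pcf_Gamma \<theta> \<sigma> \<mu> A) \<le>o pp_Gamma \<theta> \<sigma> \<mu>"
proof (rule ccontr)
  assume contra: "\<not> ?thesis"
  let ?pp = "pp_Gamma \<theta> \<sigma> \<mu>"
  have \<mu>: "Card_order \<mu>" "infinite (Field \<mu>)"
    using assms(1) by (auto simp: singular_cardinal_def)
  note wo = Card_order_Well_order[OF \<mu>(1)]
  have \<sigma>: "infinite (Field \<sigma>)" "Card_order \<sigma>"
    using assms(2) by (auto simp: regular_cardinal_def)
  obtain K where K: "K \<subseteq> Field \<mu>" "cofinal K \<mu>" "cf \<mu> = |K|"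
    by (rule cf_attained[OF \<mu>]) blast
  have infK: "infinite K"
    using card_of_ordLeq_infinite[OF card_of_mono2[OF assms(5)] \<sigma>(1)] K(3) by (simp add: Field_card_of)
  have K\<theta>: "|K| <o cf \<theta>" "|K| <o \<theta>"
    using assms(6) ordLess_ordLeq_trans[OF assms(6,7)] K(3) by simp_all
  have inf\<theta>: "infinite (Field \<theta>)"
    using card_of_ordLeq_infinite[OF card_of_mono2[OF ordLess_imp_ordLeq[OF K\<theta>(2)]]] infK
    by (simp add: Field_card_of)
  \<comment> \<open>The point \<open>z\<close> represents \<open>\<theta>\<close> inside
    \<open>\<mu>\<close>, so every point from \<open>\<eta>0\<close> on represents an ordinal larger
    than \<open>\<theta>\<close>. This is what later allows \<open>\<theta>\<close> to serve as
    \<open>\<rho>\<close>.\<close>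
  obtain z where z: "z \<in> Field \<mu>" "\<theta> =o ord_of \<mu> z"
    using ordLess_iff_ordIso_Restr[OF wo Card_order_Well_order[OF assms(3)]] assms(8)
    unfolding ord_of_def by blast
  obtain \<eta>0 where \<eta>0: "\<eta>0 \<in> Field \<mu>" "z \<noteq> \<eta>0" "(z, \<eta>0) \<in> \<mu>"
    using infinite_Card_order_limit[OF \<mu> z(1)] by blast
  have big: "\<theta> <o ord_of \<mu> a" if "(\<eta>0, a) \<in> \<mu>" for a
  proof -
    have "(z, a) \<in> \<mu>" by (rule Well_order_trans[OF wo \<eta>0(3) that])
    moreover have "z \<noteq> a" using Well_order_antisym[OF wo \<eta>0(3)] that \<eta>0(2) by blast
    ultimately show ?thesis
      by (rule ordIso_ordLess_trans[OF z(2) ord_of_strict_mono[OF wo]])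
  qed
  have "Card_order \<kappa>" if "\<kappa> \<in> PP_Gamma \<theta> \<sigma> \<mu>" for \<kappa>
    using that unfolding PP_Gamma_def has_tcf_def regular_cardinal_def by blast
  then have "is_card_sup (PP_Gamma \<theta> \<sigma> \<mu>) ?pp"
    unfolding pp_Gamma_def by (rule is_card_sup_card_sup)
  then have pp: "Card_order ?pp" "\<forall>\<kappa>\<in>PP_Gamma \<theta> \<sigma> \<mu>. \<kappa> \<le>o ?pp"
    unfolding is_card_sup_def by blast+
  have "\<forall>\<eta>\<in>Field \<mu>. \<exists>A J B (\<kappa>::('a \<Rightarrow> 'a) rel). A \<subseteq> Reg_below \<mu> \<and> (\<forall>a\<in>A. (\<eta>, a) \<in> \<mu> \<and> (\<eta>0, a) \<in> \<mu>) \<and>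
      complete_ideal_on \<sigma> A J \<and> B \<subseteq> A \<and> A - B \<in> J \<and> |B| <o \<theta> \<and> has_tcf \<mu> A J \<kappa> \<and> ?pp <o \<kappa>"
  proof
    fix \<eta> assume \<eta>: "\<eta> \<in> Field \<mu>"
    obtain \<zeta> where \<zeta>: "\<zeta> \<in> Field \<mu>" "(\<eta>, \<zeta>) \<in> \<mu>" "(\<eta>0, \<zeta>) \<in> \<mu>"
      using Well_order_total[OF wo \<eta> \<eta>0(1)] Well_order_total[OF wo \<eta> \<eta>]
        Well_order_total[OF wo \<eta>0(1) \<eta>0(1)] \<eta> \<eta>0(1) by blast
    obtain A where A: "A \<subseteq> {a \<in> Reg_below \<mu>. (\<zeta>, a) \<in> \<mu>}"
      and nle: "\<not> card_sup (pcf_Gamma \<theta> \<sigma> \<mu> A) \<le>o ?pp"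
      using contra \<zeta>(1) by blast
    have "Card_order \<kappa>" if "\<kappa> \<in> pcf_Gamma \<theta> \<sigma> \<mu> A" for \<kappa>
      using that unfolding pcf_Gamma_def has_tcf_def regular_cardinal_def by blast
    then have "is_card_sup (pcf_Gamma \<theta> \<sigma> \<mu> A) (card_sup (pcf_Gamma \<theta> \<sigma> \<mu> A))"
      by (rule is_card_sup_card_sup)
    \<comment> \<open>If every member were at most \<open>?pp\<close>, so would be their least upper
      bound; both suprema are orders on the same type.\<close>
    with nle pp(1) obtain \<kappa> where \<kappa>: "\<kappa> \<in> pcf_Gamma \<theta> \<sigma> \<mu> A" "\<not> \<kappa> \<le>o ?pp"
      unfolding is_card_sup_def by blast
    then obtain J B where J: "complete_ideal_on \<sigma> A J" "B \<in> dual_filter A J" "|B| <o \<theta>"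
      "has_tcf \<mu> A J \<kappa>"
      unfolding pcf_Gamma_def by blast
    have "Card_order \<kappa>" using J(4) by (simp add: has_tcf_def regular_cardinal_def)
    then have pp\<kappa>: "?pp <o \<kappa>"
      using \<kappa>(2) not_ordLeq_iff_ordLess[OF Card_order_Well_order[OF pp(1)] Card_order_Well_order]
      by blast
    obtain X where "X \<in> J" "B = A - X" using J(2) unfolding dual_filter_def by blast
    moreover from this have "X \<subseteq> A" using J(1) proper_idealD(1) unfolding complete_ideal_on_def by blast
    ultimately have "A - B \<in> J" "B \<subseteq> A" by (auto simp: double_diff)
    moreover have "\<forall>a\<in>A. (\<eta>, a) \<in> \<mu> \<and> (\<eta>0, a) \<in> \<mu>"
      using A Well_order_trans[OF wo \<zeta>(2)] Well_order_trans[OF wo \<zeta>(3)] by blast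
    moreover have "A \<subseteq> Reg_below \<mu>" using A by blast
    ultimately show "\<exists>A J B (\<kappa>::('a \<Rightarrow> 'a) rel). A \<subseteq> Reg_below \<mu> \<and>
      (\<forall>a\<in>A. (\<eta>, a) \<in> \<mu> \<and> (\<eta>0, a) \<in> \<mu>) \<and>
      complete_ideal_on \<sigma> A J \<and> B \<subseteq> A \<and> A - B \<in> J \<and> |B| <o \<theta> \<and> has_tcf \<mu> A J \<kappa> \<and> ?pp <o \<kappa>"
      using J(1,3,4) pp\<kappa> by (intro exI[of _ A] exI[of _ J] exI[of _ B] exI[of _ \<kappa>] conjI)
  qed
  then obtain A J B and \<kappa> :: "'a \<Rightarrow> ('a \<Rightarrow> 'a) rel" where
    "\<forall>\<eta>\<in>Field \<mu>. A \<eta> \<subseteq> Reg_below \<mu> \<and> (\<forall>a\<in>A \<eta>. (\<eta>, a) \<in> \<mu> \<and> (\<eta>0, a) \<in> \<mu>) \<and>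
      complete_ideal_on \<sigma> (A \<eta>) (J \<eta>) \<and> B \<eta> \<subseteq> A \<eta> \<and> A \<eta> - B \<eta> \<in> J \<eta> \<and> |B \<eta>| <o \<theta> \<and>
      has_tcf \<mu> (A \<eta>) (J \<eta>) (\<kappa> \<eta>) \<and> ?pp <o \<kappa> \<eta>"
    unfolding bchoice_iff by (elim exE)
  then have *: "A \<eta> \<subseteq> Reg_below \<mu> \<and> (\<forall>a\<in>A \<eta>. (\<eta>, a) \<in> \<mu> \<and> (\<eta>0, a) \<in> \<mu>) \<and>
      complete_ideal_on \<sigma> (A \<eta>) (J \<eta>) \<and> B \<eta> \<subseteq> A \<eta> \<and> A \<eta> - B \<eta> \<in> J \<eta> \<and> |B \<eta>| <o \<theta> \<and>
      has_tcf \<mu> (A \<eta>) (J \<eta>) (\<kappa> \<eta>) \<and> ?pp <o \<kappa> \<eta>" if "\<eta> \<in> K" for \<eta>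
    using K(1) that by blast
  have A_Reg: "A \<eta> \<subseteq> Reg_below \<mu>" and A_ge: "a \<in> A \<eta> \<Longrightarrow> (\<eta>, a) \<in> \<mu>" "a \<in> A \<eta> \<Longrightarrow> (\<eta>0, a) \<in> \<mu>"
    and cJ: "complete_ideal_on \<sigma> (A \<eta>) (J \<eta>)" and BA: "B \<eta> \<subseteq> A \<eta>" and ABJ: "A \<eta> - B \<eta> \<in> J \<eta>"
    and B\<theta>: "|B \<eta>| <o \<theta>" and tcf: "has_tcf \<mu> (A \<eta>) (J \<eta>) (\<kappa> \<eta>)" and pp_less: "?pp <o \<kappa> \<eta>"
    if "\<eta> \<in> K" for \<eta> a
    using *[OF that] by blast+
  have pJ: "proper_ideal_on (A \<eta>) (J \<eta>)" if "\<eta> \<in> K" for \<eta>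
    using cJ[OF that] by (simp add: complete_ideal_on_def)
  have BJ: "B \<eta> \<notin> J \<eta>" if \<eta>: "\<eta> \<in> K" for \<eta>
  proof
    assume "B \<eta> \<in> J \<eta>"
    from proper_idealD(5)[OF pJ[OF \<eta>] this ABJ[OF \<eta>]] have "B \<eta> \<union> (A \<eta> - B \<eta>) \<in> J \<eta>" .
    moreover have "B \<eta> \<union> (A \<eta> - B \<eta>) = A \<eta>" using BA[OF \<eta>] by blast
    ultimately show False using proper_idealD(3)[OF pJ[OF \<eta>]] by simp
  qed
  define U where "U = (\<Union>\<eta>\<in>K. B \<eta>)"
  define I where "I = eventual_ideal \<mu> K B J"
  have cI: "complete_ideal_on \<sigma> U I"
    unfolding U_def I_def by (rule complete_eventual_ideal[OF \<mu> K(1,2) \<sigma> assms(5) cJ BJ])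
  then have pI: "proper_ideal_on U I" by (simp add: complete_ideal_on_def)
  have U_small: "|U| <o \<theta>"
    unfolding U_def by (rule card_of_UNION_ordLess_cf[OF assms(3) inf\<theta> infK K\<theta> B\<theta>])
  have U_Reg: "U \<subseteq> Reg_below \<mu>" using BA A_Reg unfolding U_def by blast
  have U_big: "\<theta> <o ord_of \<mu> a" if "a \<in> U" for a
    using that big A_ge(2) BA unfolding U_def by blast
  interpret regular_product \<mu> U \<theta>
    by unfold_locales (fact wo U_Reg assms(3) inf\<theta> U_small U_big)+
  obtain C and \<tau> :: "('a \<Rightarrow> 'a) rel" where C: "C \<subseteq> U" "C \<notin> I"
    and tcfC: "has_tcf \<mu> U (concentrate U I C) \<tau>"
    using ex_concentrated_tcf[OF pI] by blast
  let ?I = "concentrate U I C"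
  have U_cofinal: "cofinal U \<mu>"
    unfolding cofinal_def
  proof
    fix x assume "x \<in> Field \<mu>"
    then obtain \<eta> where \<eta>: "\<eta> \<in> K" "x \<noteq> \<eta>" "(x, \<eta>) \<in> \<mu>" using K(2) unfolding cofinal_def by blast
    obtain b where b: "b \<in> B \<eta>" using BJ[OF \<eta>(1)] proper_idealD(2)[OF pJ[OF \<eta>(1)]] by fastforce
    then have \<eta>b: "(\<eta>, b) \<in> \<mu>" using A_ge(1)[OF \<eta>(1)] BA[OF \<eta>(1)] by blast
    have "(x, b) \<in> \<mu>" by (rule Well_order_trans[OF wo \<eta>(3) \<eta>b])
    moreover have "x \<noteq> b" using Well_order_antisym[OF wo \<eta>(3)] \<eta>b \<eta>(2) by blast
    ultimately show "\<exists>b\<in>U. x \<noteq> b \<and> (x, b) \<in> \<mu>" using b \<eta>(1) unfolding U_def by blast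
  qed
  \<comment> \<open>A set bounded by \<open>x\<close> misses \<open>B \<eta>\<close> for every
    \<open>\<eta>\<close> beyond \<open>x\<close>, because all members of \<open>B \<eta>\<close>
    are at least \<open>\<eta>\<close>.\<close>
  have bounded_in: "X \<in> ?I" if X: "X \<subseteq> U" "x \<in> Field \<mu>" "\<forall>b\<in>X. (b, x) \<in> \<mu>" for X x
  proof -
    have "X \<inter> C \<inter> B \<eta> = {}" if \<eta>: "\<eta> \<in> K" "(x, \<eta>) \<in> \<mu>" "x \<noteq> \<eta>" for \<eta>
    proof -
      have "b \<notin> B \<eta>" if b: "b \<in> X" for b
      proof
        assume "b \<in> B \<eta>"
        then have "(\<eta>, b) \<in> \<mu>" using A_ge(1)[OF \<eta>(1)] BA[OF \<eta>(1)] by blast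
        moreover have "(b, x) \<in> \<mu>" using X(3) b by blast
        ultimately have "(\<eta>, x) \<in> \<mu>" by (rule Well_order_trans[OF wo])
        then show False using Well_order_antisym[OF wo \<eta>(2)] \<eta>(3) by blast
      qed
      then show ?thesis by blast
    qed
    then have "X \<inter> C \<inter> B \<eta> \<in> J \<eta>" if "\<eta> \<in> K" "(x, \<eta>) \<in> \<mu>" "x \<noteq> \<eta>" for \<eta>
      using that proper_idealD(2)[OF pJ[OF that(1)]] by simp
    then have "X \<inter> C \<in> I"
      using X(1,2) unfolding I_def U_def eventual_ideal_def by blast
    then show ?thesis using X(1) by (simp add: concentrate_def)
  qed
  have "\<tau> \<in> PP_Gamma \<theta> \<sigma> \<mu>"
    unfolding PP_Gamma_def
    using U_Reg U_cofinal U_small complete_ideal_concentrate[OF cI C] tcfC bounded_in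
    by (intro CollectI exI[of _ U] exI[of _ ?I]) blast
  then have \<tau>_less: "\<tau> <o \<kappa> \<eta>" if "\<eta> \<in> K" for \<eta>
    using ordLeq_ordLess_trans[OF _ pp_less[OF that]] pp(2) by blast
  obtain F where reg: "regular_cardinal \<tau>" and F: "\<And>\<alpha>. \<alpha> \<in> Field \<tau> \<Longrightarrow> F \<alpha> \<in> Prod \<mu> U"
    and inc: "\<And>\<alpha> \<beta>. \<alpha> \<noteq> \<beta> \<Longrightarrow> (\<alpha>, \<beta>) \<in> \<tau> \<Longrightarrow> less_mod \<mu> U ?I (F \<alpha>) (F \<beta>)"
    and cof: "\<And>g. g \<in> Prod \<mu> U \<Longrightarrow> \<exists>\<alpha>\<in>Field \<tau>. le_mod \<mu> U ?I g (F \<alpha>)"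
    using tcfC unfolding has_tcf_def by blast
  have \<tau>: "Card_order \<tau>" "infinite (Field \<tau>)" using reg by (auto simp: regular_cardinal_def)
  \<comment> \<open>Default values at points of \<open>A \<eta>\<close> outside \<open>U\<close>,
    used to extend the terms \<open>F \<alpha>\<close> to members of the product over
    \<open>A \<eta>\<close>.\<close>
  have "\<forall>a\<in>Reg_below \<mu>. \<exists>y. y \<in> underS \<mu> a"
  proof
    fix a assume "a \<in> Reg_below \<mu>"
    then have "infinite (underS \<mu> a)"
      using Field_ord_of[OF wo, of a] by (auto simp: Reg_below_def regular_cardinal_def)
    then have "underS \<mu> a \<noteq> {}" by (rule infinite_imp_nonempty)
    then show "\<exists>y. y \<in> underS \<mu> a" by blast
  qed
  then obtain o0 where o0: "\<forall>a\<in>Reg_below \<mu>. o0 a \<in> underS \<mu> a" unfolding bchoice_iff by (elim exE)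
  have "\<forall>\<eta>\<in>K. \<exists>g. g \<in> Prod \<mu> (A \<eta>) \<and>
      (\<forall>\<alpha>\<in>Field \<tau>. {a \<in> A \<eta> \<inter> U. (F \<alpha> a, g a) \<notin> \<mu>} \<in> J \<eta>)"
  proof
    fix \<eta> assume \<eta>: "\<eta> \<in> K"
    define G where "G \<alpha> = restrict (\<lambda>a. if a \<in> U then F \<alpha> a else o0 a) (A \<eta>)" for \<alpha>
    have "G \<alpha> \<in> Prod \<mu> (A \<eta>)" if "\<alpha> \<in> Field \<tau>" for \<alpha>
      using P_underS[OF F[OF that]] o0 A_Reg[OF \<eta>] by (auto simp: G_def Prod_def)
    then have "G ` Field \<tau> \<subseteq> Prod \<mu> (A \<eta>)" by blast
    from has_tcf_bounded[OF wo pJ[OF \<eta>] tcf[OF \<eta>] this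
        ordLeq_ordLess_trans[OF card_of_image_Field_ordLeq[OF \<tau>(1)] \<tau>_less[OF \<eta>]]]
    obtain g where g: "g \<in> Prod \<mu> (A \<eta>)" "\<And>\<alpha>. \<alpha> \<in> Field \<tau> \<Longrightarrow> le_mod \<mu> (A \<eta>) (J \<eta>) (G \<alpha>) g" by blast
    have "{a \<in> A \<eta> \<inter> U. (F \<alpha> a, g a) \<notin> \<mu>} \<in> J \<eta>" if "\<alpha> \<in> Field \<tau>" for \<alpha>
      using g(2)[OF that] unfolding le_mod_def
      by (rule proper_idealD(4)[OF pJ[OF \<eta>]]) (auto simp: G_def)
    with g(1) show "\<exists>g. g \<in> Prod \<mu> (A \<eta>) \<and>
      (\<forall>\<alpha>\<in>Field \<tau>. {a \<in> A \<eta> \<inter> U. (F \<alpha> a, g a) \<notin> \<mu>} \<in> J \<eta>)" by blast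
  qed
  then obtain g where "\<forall>\<eta>\<in>K. g \<eta> \<in> Prod \<mu> (A \<eta>) \<and>
      (\<forall>\<alpha>\<in>Field \<tau>. {a \<in> A \<eta> \<inter> U. (F \<alpha> a, g \<eta> a) \<notin> \<mu>} \<in> J \<eta>)"
    unfolding bchoice_iff by (elim exE)
  then have g: "\<And>\<eta>. \<eta> \<in> K \<Longrightarrow> g \<eta> \<in> Prod \<mu> (A \<eta>)"
    "\<And>\<eta> \<alpha>. \<eta> \<in> K \<Longrightarrow> \<alpha> \<in> Field \<tau> \<Longrightarrow> {a \<in> A \<eta> \<inter> U. (F \<alpha> a, g \<eta> a) \<notin> \<mu>} \<in> J \<eta>"
    by blast+
  \<comment> \<open>At each \<open>a\<close> there are at most \<open>|K|\<close> values
    \<open>g \<eta> a\<close>, and \<open>|K| <o \<theta>\<close> with \<open>\<theta>\<close> below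
    the regular cardinal \<open>a\<close>.\<close>
  have "\<exists>h\<in>Prod \<mu> U. \<forall>a\<in>U. \<forall>\<eta>\<in>K. a \<in> A \<eta> \<longrightarrow> (g \<eta> a, h a) \<in> \<mu>"
  proof (rule P_choice)
    fix a assume a: "a \<in> U"
    let ?S = "(\<lambda>\<eta>. g \<eta> a) ` {\<eta> \<in> K. a \<in> A \<eta>}"
    have "regular_cardinal (ord_of \<mu> a)" using a U_Reg by (auto simp: Reg_below_def)
    moreover have "?S \<subseteq> Field (ord_of \<mu> a)"
      using g(1) by (auto simp: Field_ord_of[OF wo] Prod_def)
    moreover have "|?S| <o ord_of \<mu> a"
    proof -
      have "|?S| \<le>o |K|"
        by (rule ordLeq_transitive[OF card_of_image card_of_mono1]) blast
      from ordLess_transitive[OF ordLeq_ordLess_trans[OF this K\<theta>(2)] U_big[OF a]] show ?thesis .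
    qed
    ultimately have "\<exists>y\<in>Field (ord_of \<mu> a). \<forall>s\<in>?S. (s, y) \<in> ord_of \<mu> a"
      by (rule regular_cardinal_bounded)
    then show "\<exists>y\<in>underS \<mu> a. \<forall>\<eta>\<in>K. a \<in> A \<eta> \<longrightarrow> (g \<eta> a, y) \<in> \<mu>"
      unfolding Field_ord_of[OF wo] by (auto simp: ord_of_def)
  qed
  then obtain h where h: "h \<in> Prod \<mu> U"
    "\<And>a \<eta>. a \<in> U \<Longrightarrow> \<eta> \<in> K \<Longrightarrow> a \<in> A \<eta> \<Longrightarrow> (g \<eta> a, h a) \<in> \<mu>" by blast
  obtain \<alpha> where \<alpha>: "\<alpha> \<in> Field \<tau>" "le_mod \<mu> U ?I h (F \<alpha>)" using cof[OF h(1)] by blast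
  \<comment> \<open>A strictly later index is needed: cofinality gives only
    \<open>h \<le> F \<alpha>\<close>, whereas \<open>h < F \<beta>\<close> holds off the null set
    \<open>N\<close>.\<close>
  obtain \<beta> where \<beta>: "\<beta> \<in> Field \<tau>" "\<alpha> \<noteq> \<beta>" "(\<alpha>, \<beta>) \<in> \<tau>"
    using infinite_Card_order_limit[OF \<tau> \<alpha>(1)] by blast
  define N where "N = {a \<in> U. (h a, F \<alpha> a) \<notin> \<mu>} \<union> {a \<in> U. \<not> (F \<alpha> a \<noteq> F \<beta> a \<and> (F \<alpha> a, F \<beta> a) \<in> \<mu>)}"
  have "N \<in> ?I"
    unfolding N_def
    by (rule proper_idealD(5)[OF proper_ideal_concentrate[OF pI C]])
      (use \<alpha>(2) inc[OF \<beta>(2,3)] in \<open>simp_all add: le_mod_def less_mod_def\<close>)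
  then have "N \<inter> C \<in> I" by (simp add: concentrate_def)
  then obtain x where x: "x \<in> Field \<mu>"
    "\<And>\<eta>. \<eta> \<in> K \<Longrightarrow> (x, \<eta>) \<in> \<mu> \<Longrightarrow> x \<noteq> \<eta> \<Longrightarrow> N \<inter> C \<inter> B \<eta> \<in> J \<eta>"
    unfolding I_def eventual_ideal_def by blast
  \<comment> \<open>Outside \<open>N\<close> and the null set where
    \<open>F \<beta> \<le> g \<eta>\<close> fails, \<open>F \<beta> \<le> g \<eta> \<le> h \<le> F
    \<alpha> < F \<beta>\<close> would hold. So two null sets cover
    \<open>C \<inter> B \<eta>\<close>, which puts \<open>C\<close> into \<open>I\<close>.\<close>
  have "C \<inter> B \<eta> \<in> J \<eta>" if \<eta>: "\<eta> \<in> K" "(x, \<eta>) \<in> \<mu>" "x \<noteq> \<eta>" for \<eta>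
  proof (rule proper_idealD(4)[OF pJ[OF \<eta>(1)]])
    show "(N \<inter> C \<inter> B \<eta>) \<union> {a \<in> A \<eta> \<inter> U. (F \<beta> a, g \<eta> a) \<notin> \<mu>} \<in> J \<eta>"
      by (rule proper_idealD(5)[OF pJ[OF \<eta>(1)] x(2)[OF \<eta>] g(2)[OF \<eta>(1) \<beta>(1)]])
    show "C \<inter> B \<eta> \<subseteq> (N \<inter> C \<inter> B \<eta>) \<union> {a \<in> A \<eta> \<inter> U. (F \<beta> a, g \<eta> a) \<notin> \<mu>}"
    proof (rule subsetI, rule ccontr)
      fix a assume a: "a \<in> C \<inter> B \<eta>" "a \<notin> (N \<inter> C \<inter> B \<eta>) \<union> {a \<in> A \<eta> \<inter> U. (F \<beta> a, g \<eta> a) \<notin> \<mu>}"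
      have aU: "a \<in> U" "a \<in> A \<eta>" using a(1) C(1) BA[OF \<eta>(1)] by blast+
      then have 1: "(h a, F \<alpha> a) \<in> \<mu>" "F \<alpha> a \<noteq> F \<beta> a" "(F \<alpha> a, F \<beta> a) \<in> \<mu>" "(F \<beta> a, g \<eta> a) \<in> \<mu>"
        using a unfolding N_def by blast+
      have "(F \<beta> a, h a) \<in> \<mu>" by (rule Well_order_trans[OF wo 1(4) h(2)[OF aU(1) \<eta>(1) aU(2)]])
      from Well_order_trans[OF wo this 1(1)] show False
        using Well_order_antisym[OF wo 1(3)] 1(2) by blast
    qed
  qed
  then have "C \<in> I" using x(1) C(1) unfolding I_def U_def eventual_ideal_def by blast
  with C(2) show False by contradiction
qed

end
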